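(* Let $K$ be an imaginary quadratic field with ring of integers $\mathcal{O}_K$ and discriminant $\Delta_K$, let $\mathcal{O} = \mathbb{Z} + \mathfrak{f}\mathcal{O}_K$ be the order of conductor $\mathfrak{f}$, let $E = \mathbb{C}/\mathcal{O}$ and $E' = \mathbb{C}/\mathcal{O}_K$, and let $\iota^{\vee}: E' \to E$ be the isogeny $z + \mathcal{O}_K \mapsto \mathfrak{f} z + \mathcal{O}$ (the dual of the quotient isogeny $\iota: \mathbb{C}/\mathcal{O} \to \mathbb{C}/\mathcal{O}_K$). Put $\mathcal{K} = \ker \iota^{\vee}$. Let $\ell$ be a prime and $c = \operatorname{ord}_\ell(\mathfrak{f})$. (a) Suppose $\left(\frac{\Delta_K}{\ell}\right) = 1$ and let $\mathfrak{p}_1,\mathfrak{p}_2$ be the two primes of $\mathcal{O}_K$ over $\ell$. For integers $0 \leq a \leq b$, as abelian groups $\mathcal{K} \cap E'[\mathfrak{p}_1^a\mathfrak{p}_2^b] \cong \mathbb{Z}/\ell^{\min(a,c)}\mathbb{Z}$ and $\iota^{\vee}(E'[\mathfrak{p}_1^a\mathfrak{p}_2^b]) \cong \mathbb{Z}/\ell^{\max(a-c,0)}\mathbb{Z} \times \mathbb{Z}/\ell^b\mathbb{Z}$. (b) Suppose $\left(\frac{\Delta_K}{\ell}\right) = 0$ and let $\mathfrak{p}$ be the prime of $\mathcal{O}_K$ over $\ell$. For all $d \in \mathbb{Z}^+$, as abelian groups $\mathcal{K} \cap E'[\mathfrak{p}^d] \cong \mathbb{Z}/\ell^{\min(c,\lfloor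 d/2\rfloor)}\mathbb{Z}$ and $\iota^{\vee}(E'[\mathfrak{p}^d]) \cong \mathbb{Z}/\ell^{\max(\lfloor d/2\rfloor - c,0)}\mathbb{Z} \times \mathbb{Z}/\ell^{\lceil d/2\rceil}\mathbb{Z}$. (c) Suppose $\left(\frac{\Delta_K}{\ell}\right) = -1$. For all $b \in \mathbb{Z}^+$, as abelian groups $\mathcal{K} \cap E'[\ell^b] \cong \mathbb{Z}/\ell^{\min(b,c)}\mathbb{Z}$ and $\iota^{\vee}(E'[\ell^b]) \cong \mathbb{Z}/\ell^{\max(b-c,0)}\mathbb{Z} \times \mathbb{Z}/\ell^b\mathbb{Z}$. (The statement in (a) also holds with $\mathfrak{p}_1$ and $\mathfrak{p}_2$ interchanged.)
   Context: For an ideal $I$ of $\mathcal{O}_K$, $E'[I] = \{P \in E'(\mathbb{C}) : bP = 0 \text{ for all } b \in I\}$, where $\mathcal{O}_K$ acts on $E' = \mathbb{C}/\mathcal{O}_K$ by multiplication. $\left(\frac{\Delta_K}{\ell}\right)$ is the Kronecker symbol; equivalently it is $1,0,-1$ according as $\ell$ splits, ramifies, or is inert in $K$. *)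

theory Defs
  imports Complex_Main "HOL-Computational_Algebra.Polynomial" "HOL-Number_Theory.Number_Theory"
    "HOL-Algebra.Ideal_Product" "HOL-Algebra.Elementary_Groups" "HOL-Algebra.Embedded_Algebras"
begin

definition complex_field :: "complex ring" where
  "complex_field = \<lparr>carrier = UNIV, mult = (*), one = 1, zero = 0, add = (+)\<rparr>"

text \<open>Imaginary quadratic fields are taken inside the complex numbers, as the tori
  \<open>\<complex>/\<O>\<close> require.\<close>

definition imaginary_quadratic_field :: "complex set \<Rightarrow> bool" where
  "imaginary_quadratic_field K \<longleftrightarrow>
     subfield K complex_field \<and> ring.dimension complex_field 2 \<rat> K \<and> \<not> K \<subseteq> \<real>"

definition integers_of :: "complex set \<Rightarrow> complex set" where
  "integers_of K = {x \<in> K. algebraic_int x}"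

definition integer_ring :: "complex set \<Rightarrow> complex ring" where
  "integer_ring K = complex_field\<lparr>carrier := integers_of K\<rparr>"

definition quadratic_order :: "complex set \<Rightarrow> nat \<Rightarrow> complex set" where
  "quadratic_order K f = {of_int m + of_nat f * w | m w. w \<in> integers_of K}"

definition integral_basis :: "complex set \<Rightarrow> complex \<Rightarrow> complex \<Rightarrow> bool" where
  "integral_basis K w1 w2 \<longleftrightarrow>
     integers_of K = {of_int m * w1 + of_int n * w2 | m n. True} \<and>
     (\<forall>m n. of_int m * w1 + of_int n * w2 = 0 \<longrightarrow> m = 0 \<and> n = 0)"

text \<open>The embeddings of an imaginary quadratic field are the inclusion and complex conjugation,
  so the discriminant is the square of the determinant of \<open>(w1, w2)\<close> and its conjugate.\<close>

definition field_discriminant :: "complex set \<Rightarrow> int" where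
  "field_discriminant K =
     (THE D. \<exists>w1 w2. integral_basis K w1 w2 \<and> of_int D = (w1 * cnj w2 - w2 * cnj w1)\<^sup>2)"

text \<open>The Kronecker symbol with a prime lower argument.\<close>

definition kronecker_prime :: "int \<Rightarrow> nat \<Rightarrow> int" where
  "kronecker_prime D p =
     (if p = 2
      then (if even D then 0 else if D mod 8 = 1 \<or> D mod 8 = 7 then 1 else -1)
      else Legendre D (int p))"

definition primes_over :: "complex set \<Rightarrow> nat \<Rightarrow> complex set set" where
  "primes_over K l = {P. primeideal P (integer_ring K) \<and> of_nat l \<in> P}"

abbreviation ideal_power :: "complex set \<Rightarrow> complex set \<Rightarrow> nat \<Rightarrow> complex set" where
  "ideal_power K P n \<equiv> P [^]\<^bsub>ideals_set (integer_ring K)\<^esub> n"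

definition complex_torus :: "complex set \<Rightarrow> complex set monoid" where
  "complex_torus L = add_monoid complex_field Mod L"

text \<open>The map \<open>z + L \<mapsto> b z + L'\<close> into the torus of \<open>L'\<close>, given on cosets as sets; it is
  meaningful when \<open>b L \<subseteq> L'\<close>, see \<open>torus_mult_coset\<close> below.\<close>

definition torus_mult :: "complex set \<Rightarrow> complex \<Rightarrow> complex set \<Rightarrow> complex set" where
  "torus_mult L' b X = (\<Union>z\<in>X. L' +>\<^bsub>complex_field\<^esub> (b * z))"

definition torus_torsion :: "complex set \<Rightarrow> complex set \<Rightarrow> complex set set" where
  "torus_torsion K I =
     {P \<in> carrier (complex_torus (integers_of K)).
        \<forall>b\<in>I. torus_mult (integers_of K) b P = \<one>\<^bsub>complex_torus (integers_of K)\<^esub>}"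

definition iota_dual :: "complex set \<Rightarrow> nat \<Rightarrow> complex set \<Rightarrow> complex set" where
  "iota_dual K f = torus_mult (quadratic_order K f) (of_nat f)"

definition iota_dual_kernel :: "complex set \<Rightarrow> nat \<Rightarrow> complex set set" where
  "iota_dual_kernel K f =
     kernel (complex_torus (integers_of K)) (complex_torus (quadratic_order K f)) (iota_dual K f)"

definition kernel_torsion_group :: "complex set \<Rightarrow> nat \<Rightarrow> complex set \<Rightarrow> complex set monoid" where
  "kernel_torsion_group K f I =
     (complex_torus (integers_of K))\<lparr>carrier := iota_dual_kernel K f \<inter> torus_torsion K I\<rparr>"

definition image_torsion_group :: "complex set \<Rightarrow> nat \<Rightarrow> complex set \<Rightarrow> complex set monoid" where
  "image_torsion_group K f I =
     (complex_torus (quadratic_order K f))\<lparr>carrier := iota_dual K f ` torus_torsion K I\<rparr>"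

lemma complex_coset_eq: "L +>\<^bsub>complex_field\<^esub> z = {w + z | w. w \<in> L}"
  by (auto simp: a_r_coset_def r_coset_def complex_field_def)

lemma torus_mult_coset:
  assumes zero: "0 \<in> L" and add: "\<And>x y. x \<in> L' \<Longrightarrow> y \<in> L' \<Longrightarrow> x + y \<in> L'"
    and incl: "\<And>x. x \<in> L \<Longrightarrow> b * x \<in> L'"
  shows "torus_mult L' b (L +>\<^bsub>complex_field\<^esub> z) = L' +>\<^bsub>complex_field\<^esub> (b * z)"
proof
  show "torus_mult L' b (L +>\<^bsub>complex_field\<^esub> z) \<subseteq> L' +>\<^bsub>complex_field\<^esub> (b * z)"
  proof
    fix t assume "t \<in> torus_mult L' b (L +>\<^bsub>complex_field\<^esub> z)"
    then obtain w x where w: "w \<in> L'" and x: "x \<in> L" and t: "t = w + b * (x + z)"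
      unfolding torus_mult_def complex_coset_eq by blast
    have "w + b * x \<in> L'" using w x add incl by blast
    moreover have "t = (w + b * x) + b * z" using t by (simp add: algebra_simps)
    ultimately show "t \<in> L' +>\<^bsub>complex_field\<^esub> (b * z)"
      unfolding complex_coset_eq by blast
  qed
  have "z \<in> L +>\<^bsub>complex_field\<^esub> z"
    unfolding complex_coset_eq using zero by force
  then show "L' +>\<^bsub>complex_field\<^esub> (b * z) \<subseteq> torus_mult L' b (L +>\<^bsub>complex_field\<^esub> z)"
    unfolding torus_mult_def by blast
qed

end

theory Submission
  imports Defs "HOL-Computational_Algebra.Squarefree"
begin

text \<open>Every ideal \<open>I\<close> in question satisfies \<open>I\<inverse> = \<int> l\<^bsup>-a\<^esup> + \<int> l\<^bsup>-b\<^esup> v\<close> for some \<open>v\<close> with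
  \<open>\<O>\<^sub>K = \<int> + \<int> v\<close>.  Since \<open>\<O> = \<int> + \<int> \<ff> v\<close>, multiplication by \<open>\<ff>\<close> then acts on the two coordinates of
  \<open>E'[I] = I\<inverse> / \<O>\<^sub>K\<close> separately: on the second one it is injective modulo \<open>\<O>\<close>, on the first one it
  kills exactly the \<open>l\<^sup>c\<close>-torsion.

  For inert \<open>l\<close> the shape of \<open>I\<inverse>\<close> is obvious.  For split \<open>l\<close>, the relation \<open>\<pp>\<^sub>1 \<pp>\<^sub>2 = (l)\<close> reduces to
  \<open>\<pp>\<^sub>2\<^bsup>-k\<^esup> = \<int> + \<int> l\<^bsup>-k\<^esup> (w - r)\<close>, where \<open>r\<close> is the Hensel lift modulo \<open>l\<^sup>k\<close> of a root of the minimal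
  polynomial of \<open>w\<close>.  For ramified \<open>l\<close>, \<open>\<pp>\<^sup>2 = (l)\<close> by maximality of \<open>\<O>\<^sub>K\<close>, and
  \<open>\<pp>\<inverse> = \<int> + \<int> l\<inverse> (w - r)\<close> for the double root \<open>r\<close>.\<close>

section \<open>Integers and discriminant of an imaginary quadratic field\<close>

text \<open>What makes adapted bases available is that replacing \<open>w\<close> by
  \<open>w - r\<close> with an integer \<open>r\<close> changes neither O_K nor O. So
  \<open>r\<close> may depend on the ideal, even on its exponents, while the order of conductor f
  keeps the basis 1, f v. It remains to find, for each ideal, one translate for which the relations
  become diagonal. Inverse ideals enter only through the operators M |-> \<open>colon M I\<close>. A
  product of ideals acts as a composition of such operators, and these commute. Hence identities
  such as P1 P2 = (l) or P^2 = (l) are verified only in their effect on Z[w]-modules M inside the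
  complex numbers, and ideal products are never computed. The condition a <= b leaves surplus
  factors of P2 alone once pairs are cancelled, so one root handles them all. In the ramified case
  at most one factor survives, which is the source of the floor and the ceiling of d/2.\<close>

lemma map_poly_of_int_mult:
  "map_poly of_int (p * q) = map_poly of_int p * (map_poly of_int q :: 'a :: comm_ring_1 poly)"
  by (rule poly_eqI) (simp add: coeff_map_poly coeff_mult)

lemma map_poly_of_int_add:
  "map_poly of_int (p + q) = map_poly of_int p + (map_poly of_int q :: 'a :: comm_ring_1 poly)"
  by (rule poly_eqI) (simp add: coeff_map_poly)

lemma map_poly_of_int_smult:
  "map_poly of_int (Polynomial.smult c p) = Polynomial.smult (of_int c) (map_poly of_int p :: 'a :: comm_ring_1 poly)"
  by (rule poly_eqI) (simp add: coeff_map_poly)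

text \<open>Up to sign the primitive part \<open>q\<close> of the quadratic is the minimal
  polynomial of \<open>x\<close>. Pseudo-dividing a monic \<open>p\<close> that kills
  \<open>x\<close> by \<open>q\<close> leaves a remainder of degree at most 1, and a nonreal number
  is no root of a nonzero integer polynomial of that degree. So \<open>q\<close> divides a multiple
  of \<open>p\<close>, hence \<open>p\<close> by Gauss, and its leading coefficient is a unit; then
  \<open>a\<close> is the content of the quadratic up to sign.\<close>

lemma algebraic_int_quadratic_dvd:
  fixes x :: complex and a b c :: int
  assumes x: "algebraic_int x" and im: "Im x \<noteq> 0" and a: "a \<noteq> 0"
    and eq: "of_int a * x^2 + of_int b * x + of_int c = 0"
  shows "a dvd b \<and> a dvd c"
proof -
  define q0 where "q0 = [:c, b, a:]"
  define k where "k = content q0"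
  define q where "q = primitive_part q0"
  have q0: "q0 = Polynomial.smult k q" by (simp add: k_def q_def)
  have "q0 \<noteq> 0" using a by (simp add: q0_def)
  hence k0: "k \<noteq> 0" by (simp add: k_def)
  have cq: "content q = 1" using \<open>q0 \<noteq> 0\<close> by (simp add: q_def)
  have deg: "degree q = 2" using a by (simp add: q_def q0_def)
  have "poly (map_poly of_int q0) x = 0"
    using eq by (simp add: q0_def map_poly_pCons algebra_simps power2_eq_square)
  hence qx: "poly (map_poly of_int q) x = 0"
    using k0 by (simp add: q0 map_poly_of_int_smult)
  obtain p :: "int poly" where px: "poly (map_poly of_int p) x = 0" and lp: "lead_coeff p = 1"
    using x by (auto simp: algebraic_int_altdef_ipoly)
  obtain h r where hr: "pseudo_divmod p q = (h, r)" by fastforce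
  have "q \<noteq> 0" using deg by auto
  define m where "m = lead_coeff q ^ (Suc (degree p) - degree q)"
  have m0: "m \<noteq> 0" using \<open>q \<noteq> 0\<close> by (simp add: m_def)
  have div: "Polynomial.smult m p = q * h + r" and r: "r = 0 \<or> degree r < degree q"
    using pseudo_divmod[OF \<open>q \<noteq> 0\<close> hr] by (simp_all add: m_def)
  have "poly (map_poly of_int (Polynomial.smult m p)) x = poly (map_poly of_int (q * h + r)) x"
    by (simp add: div)
  hence rx: "poly (map_poly of_int r) x = 0"
    using px qx by (simp add: map_poly_of_int_smult map_poly_of_int_mult map_poly_of_int_add)
  have "degree r \<le> 1" using r deg by auto
  then obtain r0 r1 where r01: "r = [:r0, r1:]"
    by (metis degree1_coeffs degree_eq_zeroE less_one order_le_imp_less_or_eq pCons_0_0)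
  have e: "of_int r0 + x * of_int r1 = 0"
    using rx by (simp add: r01 map_poly_pCons)
  have "Im (of_int r0 + x * of_int r1) = 0" unfolding e by simp
  hence "r1 = 0" using im by simp
  moreover from this e have "r0 = 0" by simp
  ultimately have "r = 0" by (simp add: r01)
  with div have div': "Polynomial.smult m p = q * h" by simp
  have cp: "content p = 1"
    by (metis content_dvd_coeff lp is_unit_content_iff)
  txt \<open>Gauss: \<open>q\<close> is primitive, so \<open>m\<close> already divides \<open>h\<close>.\<close>
  have "content (q * h) = normalize m" by (simp add: div'[symmetric] cp)
  hence ch: "content h = normalize m" by (simp add: content_mult cq)
  obtain h' where h': "h = Polynomial.smult m h'"
  proof -
    have "[:m:] dvd h" by (simp add: const_poly_dvd_iff_dvd_content ch)
    thus ?thesis using that by (auto simp: dvd_def)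
  qed
  have "Polynomial.smult m p = Polynomial.smult m (q * h')" using div' by (simp add: h')
  hence "p = q * h'" using m0 smult_cancel by blast
  hence "lead_coeff q * lead_coeff h' = 1" using lp by (simp add: lead_coeff_mult)
  hence u: "is_unit (lead_coeff q)" by (metis dvd_triv_left)
  have "a = k * poly.coeff q 2" "b = k * poly.coeff q 1" "c = k * poly.coeff q 0"
    using arg_cong[OF q0, of "\<lambda>p. poly.coeff p 2"] arg_cong[OF q0, of "\<lambda>p. poly.coeff p 1"]
      arg_cong[OF q0, of "\<lambda>p. poly.coeff p 0"] by (simp_all add: q0_def numeral_2_eq_2)
  thus ?thesis using u unfolding deg by (metis dvd_trans mult_dvd_mono dvd_refl unit_imp_dvd)
qed

lemma complex_field_ring: "ring complex_field"
proof (rule ringI)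
  have "\<exists>y. y + x = 0" for x :: complex
    by (metis add.left_inverse)
  thus "abelian_group complex_field"
    by (intro abelian_groupI) (simp_all add: complex_field_def add.assoc add.commute)
  show "monoid complex_field"
    by (rule monoidI) (simp_all add: complex_field_def mult.assoc)
qed (simp_all add: complex_field_def distrib_left distrib_right)

lemma imaginary_quadratic_field_props:
  assumes "imaginary_quadratic_field K"
  shows "1 \<in> K" "\<And>x y. x \<in> K \<Longrightarrow> y \<in> K \<Longrightarrow> x + y \<in> K" "\<And>x y. x \<in> K \<Longrightarrow> y \<in> K \<Longrightarrow> x * y \<in> K"
    "\<rat> \<subseteq> K"
    "\<exists>u v. K = {p * u + q * v | p q. p \<in> \<rat> \<and> q \<in> \<rat>}"
proof -
  interpret ring complex_field by (rule complex_field_ring)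
  have K: "subfield K complex_field" and d: "dimension 2 \<rat> K"
    using assms by (auto simp: imaginary_quadratic_field_def)
  have r: "subring K complex_field"
    using K by (simp add: subfield_def subdomain_def subcring_def)
  show "1 \<in> K" "\<And>x y. x \<in> K \<Longrightarrow> y \<in> K \<Longrightarrow> x + y \<in> K" "\<And>x y. x \<in> K \<Longrightarrow> y \<in> K \<Longrightarrow> x * y \<in> K"
    using subringE[OF r] by (simp_all add: complex_field_def)
  from d obtain v u where K': "K = line_extension \<rat> v (line_extension \<rat> u {\<zero>\<^bsub>complex_field\<^esub>})"
  proof -
    obtain v E where "K = line_extension \<rat> v E" "dimension 1 \<rat> E"
      using d by (cases rule: dimension.cases) (auto simp: numeral_2_eq_2)
    moreover from this(2) obtain u E' where "E = line_extension \<rat> u E'" "dimension 0 \<rat> E'"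
      by (cases rule: dimension.cases) auto
    moreover from this(2) have "E' = {\<zero>\<^bsub>complex_field\<^esub>}"
      by (cases rule: dimension.cases) auto
    ultimately show ?thesis using that by blast
  qed
  have "K = {p * v + q * u | p q. p \<in> \<rat> \<and> q \<in> \<rat>}"
  proof -
    have inner: "z \<in> line_extension \<rat> u {\<zero>\<^bsub>complex_field\<^esub>} \<longleftrightarrow> (\<exists>q\<in>\<rat>. z = q * u)" for z
      by (simp add: line_extension_mem_iff) (simp add: complex_field_def)
    have outer: "z \<in> K \<longleftrightarrow> (\<exists>p\<in>\<rat>. \<exists>y\<in>line_extension \<rat> u {\<zero>\<^bsub>complex_field\<^esub>}. z = p * v + y)" for z
      unfolding K' line_extension_mem_iff[of _ _ v] by (simp add: complex_field_def)
    show ?thesis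
    proof (intro equalityI subsetI)
      fix z assume "z \<in> K"
      then obtain p y where "p \<in> \<rat>" "y \<in> line_extension \<rat> u {\<zero>\<^bsub>complex_field\<^esub>}" "z = p * v + y"
        using outer by blast
      moreover from this(2) obtain q where "q \<in> \<rat>" "y = q * u" using inner by blast
      ultimately show "z \<in> {p * v + q * u | p q. p \<in> \<rat> \<and> q \<in> \<rat>}" by blast
    next
      fix z assume "z \<in> {p * v + q * u | p q. p \<in> \<rat> \<and> q \<in> \<rat>}"
      then obtain p q where "p \<in> \<rat>" "q \<in> \<rat>" "z = p * v + q * u" by blast
      moreover from this(2) have "q * u \<in> line_extension \<rat> u {\<zero>\<^bsub>complex_field\<^esub>}" using inner by blast
      ultimately show "z \<in> K" using outer by blast
    qed
  qed
  thus ex: "\<exists>u v. K = {p * u + q * v | p q. p \<in> \<rat> \<and> q \<in> \<rat>}" by blast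
  show "\<rat> \<subseteq> K"
  proof
    fix x :: complex assume x: "x \<in> \<rat>"
    obtain u v where K: "K = {p * u + q * v | p q. p \<in> \<rat> \<and> q \<in> \<rat>}" using ex by blast
    obtain p q where "p \<in> \<rat>" "q \<in> \<rat>" "1 = p * u + q * v" using \<open>1 \<in> K\<close> unfolding K by blast
    hence "x = (x * p) * u + (x * q) * v" "x * p \<in> \<rat>" "x * q \<in> \<rat>"
      using x by (simp_all add: mult.assoc flip: distrib_left)
    thus "x \<in> K" unfolding K by blast
  qed
qed

lemma Rats_complex_real: "(p :: complex) \<in> \<rat> \<Longrightarrow> Im p = 0"
  by (auto elim!: Rats_cases')

lemma imaginary_quadratic_field_span:
  assumes K: "imaginary_quadratic_field K" and x: "x \<in> K" "Im x \<noteq> 0"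
  shows "K = {p + q * x | p q. p \<in> \<rat> \<and> q \<in> \<rat>}"
proof
  note props = imaginary_quadratic_field_props[OF K]
  show "{p + q * x | p q. p \<in> \<rat> \<and> q \<in> \<rat>} \<subseteq> K"
    using props(2-4) x(1) by blast
  obtain u v where Kuv: "K = {p * u + q * v | p q. p \<in> \<rat> \<and> q \<in> \<rat>}" using props(5) by blast
  obtain a b where ab: "a \<in> \<rat>" "b \<in> \<rat>" "1 = a * u + b * v" using props(1) unfolding Kuv by blast
  obtain c d where cd: "c \<in> \<rat>" "d \<in> \<rat>" "x = c * u + d * v" using x(1) unfolding Kuv by blast
  \<comment> \<open>Determinant of the coordinates of 1 and \<open>x\<close> in the generators
    \<open>u\<close>, \<open>v\<close>; Cramer's rule then expresses \<open>u\<close> and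
    \<open>v\<close> through 1 and \<open>x\<close>.\<close>
  define D where "D = a * d - b * c"
  have D: "D \<in> \<rat>" using ab cd by (simp add: D_def)
  have "D * u = d * (a * u + b * v) - b * (c * u + d * v)"
    "D * v = a * (c * u + d * v) - c * (a * u + b * v)"
    by (simp_all add: D_def algebra_simps)
  hence u: "D * u = d - b * x" and v: "D * v = a * x - c"
    by (simp_all flip: ab(3) cd(3))
  have "D \<noteq> 0"
  proof
    assume "D = 0"
    hence "d - b * x = 0" "a * x - c = 0" using u v by auto
    hence "Im (d - b * x) = 0" "Im (a * x - c) = 0" by (metis zero_complex.sel(2))+
    hence "Re b = 0" "Re a = 0" using x(2) Rats_complex_real ab(1,2) cd(1,2) by auto
    hence "a = 0" "b = 0" using Rats_complex_real ab(1,2) by (simp_all add: complex_eq_iff)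
    thus False using ab(3) by simp
  qed
  show "K \<subseteq> {p + q * x | p q. p \<in> \<rat> \<and> q \<in> \<rat>}"
  proof
    fix z assume "z \<in> K"
    then obtain p q where pq: "p \<in> \<rat>" "q \<in> \<rat>" "z = p * u + q * v" unfolding Kuv by blast
    have "z = (p * d - q * c) / D + ((q * a - p * b) / D) * x"
    proof -
      have "D * z = (p * d - q * c) + (q * a - p * b) * x"
      proof -
        have "D * z = p * (D * u) + q * (D * v)" by (simp add: pq(3) algebra_simps)
        thus ?thesis unfolding u v by (simp add: algebra_simps)
      qed
      hence "z = ((p * d - q * c) + (q * a - p * b) * x) / D"
        using \<open>D \<noteq> 0\<close> by (metis nonzero_mult_div_cancel_left)
      thus ?thesis by (simp add: add_divide_distrib)
    qed
    moreover have "(p * d - q * c) / D \<in> \<rat>" "(q * a - p * b) / D \<in> \<rat>"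
      using pq ab cd D by auto
    ultimately show "z \<in> {p + q * x | p q. p \<in> \<rat> \<and> q \<in> \<rat>}" by blast
  qed
qed

lemma Rats_common_denominator:
  assumes "(p :: complex) \<in> \<rat>" "q \<in> \<rat>"
  obtains a b d :: int where "d > 0" "of_int d * p = of_int a" "of_int d * q = of_int b"
proof -
  obtain a b where 1: "b > 0" "p = of_int a / of_int b" by (metis assms(1) Rats_cases')
  obtain c d where 2: "d > 0" "q = of_int c / of_int d" by (metis assms(2) Rats_cases')
  show ?thesis
    using 1 2 by (intro that[of "b * d" "a * d" "c * b"]) (auto simp: field_simps)
qed

lemma imaginary_quadratic_field_sqrt:
  assumes K: "imaginary_quadratic_field K"
  obtains N :: nat and \<delta> :: complex
  where "N > 0" "squarefree N" "\<delta>\<^sup>2 = - of_nat N" "\<delta> \<in> K" "Im \<delta> \<noteq> 0"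
proof -
  note props = imaginary_quadratic_field_props[OF K]
  obtain x where x: "x \<in> K" "Im x \<noteq> 0"
    using K unfolding imaginary_quadratic_field_def complex_is_Real_iff[symmetric] by blast
  note span = imaginary_quadratic_field_span[OF K x]
  obtain p q where pq: "p \<in> \<rat>" "q \<in> \<rat>" "x * x = p + q * x"
    using props(3)[OF x(1) x(1)] unfolding span by blast
  \<comment> \<open>Completing the square removes the linear term of the quadratic equation for
    \<open>x\<close>.\<close>
  define b where "b = x - q / 2"
  have "- q / 2 \<in> K" using props(4) pq(2) by auto
  hence bK: "b \<in> K" using props(2)[OF x(1), of "- q / 2"] by (simp add: b_def)
  have bIm: "Im b \<noteq> 0" using x(2) Rats_complex_real[OF pq(2)] by (simp add: b_def)
  define s where "s = p + q\<^sup>2 / 4"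
  have "s \<in> \<rat>" using pq by (simp add: s_def)
  have "b\<^sup>2 = x * x - q * x + q\<^sup>2 / 4"
    by (simp add: b_def power2_eq_square algebra_simps)
  hence b2: "b\<^sup>2 = s" by (simp add: pq(3) s_def)
  obtain m d :: int where md: "d > 0" "s = of_int m / of_int d"
    using \<open>s \<in> \<rat>\<close> by (metis Rats_cases')
  \<comment> \<open>One factor \<open>d\<close> clears the denominator of the square: (d b)^2 = d^2
    (m / d) = m d.\<close>
  define e where "e = of_int d * b"
  have "e\<^sup>2 = (of_int d)\<^sup>2 * s" by (simp add: e_def power_mult_distrib b2)
  hence e2: "e\<^sup>2 = of_int (m * d)" using md by (simp add: power2_eq_square)
  have "Im (e\<^sup>2) = 0" by (simp add: e2)
  \<comment> \<open>A nonreal number with real square is purely imaginary, so the integer m d is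
    negative.\<close>
  have eIm: "Im e \<noteq> 0" using bIm md by (simp add: e_def)
  with \<open>Im (e\<^sup>2) = 0\<close> have eRe: "Re e = 0" by (simp add: power2_eq_square)
  have "of_int (m * d) = Re (e\<^sup>2)" by (simp add: e2)
  also have "\<dots> = - (Im e)\<^sup>2" using eRe by (simp add: power2_eq_square)
  also have "\<dots> < 0" using eIm by simp
  finally have neg: "m * d < 0" by (simp only: of_int_less_0_iff)
  define M where "M = nat (- (m * d))"
  have "int M = - (m * d)" using neg by (simp add: M_def)
  hence "e\<^sup>2 = - of_int (int M)" using e2 by simp
  hence "M > 0" "e\<^sup>2 = - of_nat M" using neg by (simp_all add: M_def)
  define N where "N = squarefree_part M"
  define r where "r = square_part M"
  have M: "M = N * r\<^sup>2" by (simp add: N_def r_def flip: squarefree_decompose)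
  have r: "r > 0" "N > 0" using \<open>M > 0\<close> M by (auto intro: gr0I)
  define \<delta> where "\<delta> = of_rat (1 / of_nat r) * e"
  show ?thesis
  proof
    show "N > 0" by (rule r)
    show "squarefree N" by (simp add: N_def)
    show "\<delta>\<^sup>2 = - of_nat N" using r \<open>e\<^sup>2 = - of_nat M\<close>
      by (simp add: \<delta>_def power_mult_distrib M of_rat_divide field_simps)
    have "e \<in> K" unfolding e_def using props(3,4) bK by (meson Rats_of_int subsetD)
    thus "\<delta> \<in> K" unfolding \<delta>_def using props(3,4) by (meson Rats_of_rat subsetD)
    show "Im \<delta> \<noteq> 0" using r eIm by (simp add: \<delta>_def of_rat_divide)
  qed
qed

lemma square_dvd_squarefree_mult:
  fixes u v N :: nat
  assumes "squarefree N" "coprime u v" "v\<^sup>2 dvd N * u\<^sup>2"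
  shows "v = 1"
proof -
  have "coprime (v\<^sup>2) (u\<^sup>2)" using assms(2) by (simp add: coprime_commute)
  hence "v\<^sup>2 dvd N" using assms(3) coprime_dvd_mult_left_iff by blast
  thus ?thesis using squarefreeD[OF assms(1)] by simp
qed

text \<open>The square of the reduced denominator of \<open>q\<close> has to divide
  \<open>N\<close>, and a squarefree \<open>N\<close> leaves room for denominator 1 only.\<close>

lemma rational_square_mult_squarefree:
  assumes "q \<in> \<rat>" "squarefree N" "of_nat N * q\<^sup>2 = (of_int R :: complex)"
  shows "q \<in> \<int>"
proof -
  have "Im q = 0" using assms(1) by (rule Rats_complex_real)
  obtain a b :: int where ab: "b > 0" "coprime a b" "q = of_int a / of_int b"
    using assms(1) by (metis Rats_cases')
  have "of_nat N * (of_int a)\<^sup>2 = (of_int R * (of_int b)\<^sup>2 :: complex)"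
    using assms(3) ab(1) by (simp add: ab(3) power_divide field_simps)
  hence "of_int (int N * a\<^sup>2) = (of_int (R * b\<^sup>2) :: complex)" by simp
  hence "int N * a\<^sup>2 = R * b\<^sup>2" by (simp only: of_int_eq_iff)
  hence "b\<^sup>2 dvd int N * a\<^sup>2" by simp
  hence "nat (b\<^sup>2) dvd nat (int N * a\<^sup>2)" by (simp add: nat_dvd_iff)
  hence "(nat \<bar>b\<bar>)\<^sup>2 dvd N * (nat \<bar>a\<bar>)\<^sup>2"
    by (simp add: nat_mult_distrib nat_power_eq flip: nat_power_eq)
  moreover have "coprime (nat \<bar>a\<bar>) (nat \<bar>b\<bar>)"
    using ab(2) by (subst coprime_int_iff[symmetric]) simp
  ultimately have "nat \<bar>b\<bar> = 1"
    using square_dvd_squarefree_mult[OF assms(2)] by blast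
  hence "b = 1" using ab(1) by simp
  thus ?thesis by (simp add: ab(3))
qed

section \<open>Lattices with two generators, and the shape of O_K\<close>

definition lat :: "complex \<Rightarrow> complex \<Rightarrow> complex set" where
  "lat u v = {of_int i * u + of_int j * v | i j. True}"

lemma lat_iff: "x \<in> lat u v \<longleftrightarrow> (\<exists>i j. x = of_int i * u + of_int j * v)"
  by (simp add: lat_def)

lemma lat_memI: "of_int i * u + of_int j * v \<in> lat u v"
  by (auto simp: lat_def)

lemma lat_mem_left: "u \<in> lat u v"
  using lat_memI[of 1 u 0 v] by simp

lemma lat_mem_right: "v \<in> lat u v"
  using lat_memI[of 0 u 1 v] by simp

lemma algebraic_int_quadraticI:
  assumes "x * x = of_int t * x - of_int n"
  shows "algebraic_int (x :: complex)"
  unfolding algebraic_int_altdef_ipoly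
  using assms by (intro exI[of _ "[:n, - t, 1:]"]) (simp add: map_poly_pCons algebra_simps)

text \<open>For x = p + q delta the trace 2p and the norm p^2 + N q^2 are integers; then N (2q)^2 is
  one too, and 2q is integral because \<open>N\<close> is squarefree. The equation in the conclusion
  says that the norm of \<open>x\<close> is the integer \<open>M\<close>; its reduction mod 4 later
  separates the two shapes of O_K.\<close>

lemma imaginary_quadratic_integers_sqrt:
  assumes K: "imaginary_quadratic_field K" and N: "squarefree N" "\<delta>\<^sup>2 = - of_nat N"
    "\<delta> \<in> K" "Im \<delta> \<noteq> 0" and x: "x \<in> integers_of K"
  obtains A B M :: int where "x = (of_int A + of_int B * \<delta>) / 2" "A\<^sup>2 + int N * B\<^sup>2 = 4 * M"
proof (cases "Im x = 0")
  case True
  have xK: "x \<in> K" and ax: "algebraic_int x" using x by (auto simp: integers_of_def)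
  obtain p q where pq: "p \<in> \<rat>" "q \<in> \<rat>" "x = p + q * \<delta>"
    using xK imaginary_quadratic_field_span[OF K N(3,4)] by blast
  have "Im x = Re q * Im \<delta>" using Rats_complex_real pq(1,2) by (simp add: pq(3))
  hence "q = 0" using True N(4) Rats_complex_real[OF pq(2)] by (simp add: complex_eq_iff)
  hence "x \<in> \<rat>" using pq by simp
  hence "x \<in> \<int>" using rational_algebraic_int_is_int ax by blast
  then obtain a where "x = of_int a" by (auto elim: Ints_cases)
  thus ?thesis by (intro that[of "2 * a" 0 "a\<^sup>2"]) simp_all
next
  case False
  have xK: "x \<in> K" and ax: "algebraic_int x" using x by (auto simp: integers_of_def)
  obtain p q where pq: "p \<in> \<rat>" "q \<in> \<rat>" "x = p + q * \<delta>"
    using xK imaginary_quadratic_field_span[OF K N(3,4)] by blast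
  obtain P Q d where d: "d > 0" "of_int d * p = of_int P" "of_int d * q = of_int Q"
    using Rats_common_denominator[OF pq(1,2)] .
  have dx: "of_int d * x = of_int P + of_int Q * \<delta>"
    using d(2,3) by (simp add: pq(3) algebra_simps flip: d(2,3))
  \<comment> \<open>Rearranged, this is d^2 times the characteristic polynomial of \<open>x\<close>.
    That d^2 divides its integer coefficients means that trace and norm are integers.\<close>
  have "(of_int d * x)\<^sup>2 - 2 * of_int P * (of_int d * x) + (of_int P)\<^sup>2 = (of_int Q * \<delta>)\<^sup>2"
    unfolding dx by (simp add: power2_eq_square algebra_simps)
  hence "of_int (d\<^sup>2) * x\<^sup>2 + of_int (- 2 * d * P) * x + of_int (P\<^sup>2 + int N * Q\<^sup>2) = 0"
    using N(2) by (simp add: power_mult_distrib algebra_simps)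
  from algebraic_int_quadratic_dvd[OF ax False _ this]
  have "d\<^sup>2 dvd - 2 * d * P" "d\<^sup>2 dvd P\<^sup>2 + int N * Q\<^sup>2" using d(1) by auto
  have "d dvd 2 * P" using \<open>d\<^sup>2 dvd - 2 * d * P\<close> d(1) by (simp add: power2_eq_square mult.left_commute)
  then obtain A where A: "2 * P = d * A" by blast
  obtain M where M: "P\<^sup>2 + int N * Q\<^sup>2 = d\<^sup>2 * M" using \<open>d\<^sup>2 dvd P\<^sup>2 + int N * Q\<^sup>2\<close> by blast
  have "2 * of_int P = (of_int d * of_int A :: complex)" using A by (metis of_int_mult of_int_numeral)
  hence "of_int d * (2 * p) = of_int d * (of_int A :: complex)" using d(2) by (simp only: mult.left_commute[of _ 2])
  hence p: "2 * p = of_int A" using d(1) by simp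
  have "d\<^sup>2 * (A\<^sup>2) + int N * (2 * Q)\<^sup>2 = d\<^sup>2 * (4 * M)"
  proof -
    have "d\<^sup>2 * A\<^sup>2 = (2 * P)\<^sup>2" by (simp add: A power_mult_distrib)
    hence "d\<^sup>2 * A\<^sup>2 + int N * (2 * Q)\<^sup>2 = 4 * (P\<^sup>2 + int N * Q\<^sup>2)" by (simp add: algebra_simps)
    thus ?thesis by (simp add: M)
  qed
  hence R: "int N * (2 * Q)\<^sup>2 = d\<^sup>2 * (4 * M - A\<^sup>2)" by (simp add: algebra_simps)
  have "of_int (d\<^sup>2) * (of_nat N * (2 * q)\<^sup>2) = of_nat N * (2 * (of_int d * q))\<^sup>2"
    by (simp add: power_mult_distrib)
  also have "\<dots> = of_int (int N * (2 * Q)\<^sup>2)" by (simp add: d(3))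
  also have "\<dots> = of_int (d\<^sup>2) * of_int (4 * M - A\<^sup>2)" unfolding R by (rule of_int_mult)
  finally have q2: "of_nat N * (2 * q)\<^sup>2 = of_int (4 * M - A\<^sup>2)" using d(1) by simp
  have "2 * q \<in> \<int>"
    by (rule rational_square_mult_squarefree[OF _ N(1) q2]) (use pq in auto)
  then obtain B where B: "2 * q = of_int B" by (auto elim: Ints_cases)
  have "of_int (int N * B\<^sup>2) = (of_int (4 * M - A\<^sup>2) :: complex)"
    using q2 by (simp add: B)
  hence "int N * B\<^sup>2 = 4 * M - A\<^sup>2" by (simp only: of_int_eq_iff)
  show ?thesis
  proof (rule that)
    show "A\<^sup>2 + int N * B\<^sup>2 = 4 * M" using \<open>int N * B\<^sup>2 = 4 * M - A\<^sup>2\<close> by simp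
    show "x = (of_int A + of_int B * \<delta>) / 2" by (simp add: pq(3) flip: p B)
  qed
qed

text \<open>If N = 3 mod 4, the coefficients A and B only have to agree in parity, which gives w =
  (1 + delta) / 2; otherwise both are even and w = delta. The form K = Q + Q w serves the ramified
  case, where a translate of \<open>w\<close> divided by \<open>l\<close> must be seen to lie in
  \<open>K\<close>.\<close>

lemma imaginary_quadratic_integral_generator:
  assumes K: "imaginary_quadratic_field K"
  obtains w t n where "integers_of K = lat 1 w" "w * w = of_int t * w - of_int n" "Im w \<noteq> 0"
    "K = {p + q * w | p q. p \<in> \<rat> \<and> q \<in> \<rat>}"
proof -
  note props = imaginary_quadratic_field_props[OF K]
  obtain N \<delta> where N: "N > 0" "squarefree N" "\<delta>\<^sup>2 = - of_nat N" "\<delta> \<in> K" "Im \<delta> \<noteq> 0"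
    using imaginary_quadratic_field_sqrt[OF K] .
  note ints = imaginary_quadratic_integers_sqrt[OF K N(2-5)]
  have Z: "of_int i \<in> K" for i using props(4) by auto
  have N4: "int N mod 4 \<noteq> 0"
  proof
    assume "int N mod 4 = 0"
    hence "int 4 dvd int N" by (simp add: dvd_eq_mod_eq_0)
    hence "2\<^sup>2 dvd N" by (simp only: int_dvd_int_iff) simp
    thus False using squarefreeD[OF N(2), of 2] by simp
  qed
  have sq: "i\<^sup>2 mod 4 = (if even i then 0 else 1)" for i :: int
  proof (cases "even i")
    case True
    then show ?thesis by (auto elim!: evenE simp: power2_eq_square)
  next
    case False
    then obtain k where "i = 2 * k + 1" by (auto elim: oddE)
    hence "i\<^sup>2 = 4 * (k * k + k) + 1" by (simp add: power2_eq_square algebra_simps)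
    then obtain m where "i\<^sup>2 = 4 * m + 1" by blast
    then show ?thesis using False by presburger
  qed
  \<comment> \<open>Only residues mod 4 enter, so the parities of A and B follow from finitely many
    cases.\<close>
  have cong: "(A\<^sup>2 mod 4 + (int N mod 4) * (B\<^sup>2 mod 4)) mod 4 = 0" if "A\<^sup>2 + int N * B\<^sup>2 = 4 * M" for A B M
  proof -
    have "(int N mod 4) * (B\<^sup>2 mod 4) mod 4 = int N * B\<^sup>2 mod 4"
      by (rule mod_mult_eq)
    hence "(A\<^sup>2 mod 4 + (int N mod 4) * (B\<^sup>2 mod 4)) mod 4 = (A\<^sup>2 + int N * B\<^sup>2) mod 4"
      by (metis mod_add_eq mod_mod_trivial)
    thus ?thesis unfolding that by simp
  qed
  have intI: "lat 1 w \<subseteq> integers_of K"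
    if w: "w \<in> K" "w * w = of_int t * w - of_int n" for w t n
  proof
    fix x assume "x \<in> lat 1 w"
    then obtain i j where x: "x = of_int i + of_int j * w" by (auto simp: lat_def)
    have "x * x = of_int (2 * i + j * t) * x - of_int (i * i + i * j * t + j * j * n)"
    proof -
      have "x * x = of_int i * of_int i + 2 * of_int i * of_int j * w + of_int j * of_int j * (w * w)"
        by (simp add: x algebra_simps)
      also have "\<dots> = of_int (2 * i + j * t) * x - of_int (i * i + i * j * t + j * j * n)"
        unfolding w(2) by (simp add: x algebra_simps)
      finally show ?thesis .
    qed
    hence "algebraic_int x" by (rule algebraic_int_quadraticI)
    moreover have "x \<in> K" using x w(1) Z props(2,3) by simp
    ultimately show "x \<in> integers_of K" by (simp add: integers_of_def)
  qed
  show ?thesis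
  proof (cases "int N mod 4 = 3")
    case True
    define w where "w = (1 + \<delta>) / 2"
    define n where "n = (int N + 1) div 4"
    have "4 dvd int N + 1" using True by presburger
    hence n: "int N + 1 = 4 * n" by (simp add: n_def)
    have "4 * (w * w) = 1 + 2 * \<delta> + \<delta>\<^sup>2" by (simp add: w_def power2_eq_square algebra_simps)
    also have "\<dots> = 2 * (1 + \<delta>) - of_int (int N + 1)" by (simp add: N(3))
    also have "\<dots> = 4 * (w - of_int n)" unfolding n by (simp add: w_def)
    finally have "4 * (w * w) = 4 * (w - of_int n)" .
    hence "w * w = w - of_int n" by (subst (asm) mult_cancel_left) simp
    hence w2: "w * w = of_int 1 * w - of_int n" by simp
    have "w = of_rat (1/2) * (1 + \<delta>)" by (simp add: w_def of_rat_divide)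
    hence wK: "w \<in> K" using props(1-4) N(4) by (metis Rats_of_rat subsetD)
    have wI: "Im w \<noteq> 0" using N(5) by (simp add: w_def)
    have "integers_of K \<subseteq> lat 1 w"
    proof
      fix x assume "x \<in> integers_of K"
      from ints[OF this] obtain A B M where AB: "x = (of_int A + of_int B * \<delta>) / 2" "A\<^sup>2 + int N * B\<^sup>2 = 4 * M" .
      have "even (A - B)" using cong[OF AB(2)] True by (auto simp: sq split: if_splits)
      then obtain k where "A = B + 2 * k" by (metis evenE diff_eq_eq add.commute)
      hence "x = of_int k * 1 + of_int B * w" by (simp add: AB(1) w_def algebra_simps add_divide_distrib)
      thus "x \<in> lat 1 w" unfolding lat_def by blast
    qed
    thus ?thesis using that w2 wI intI[OF wK w2] imaginary_quadratic_field_span[OF K wK wI] by blast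
  next
    case False
    have d2: "\<delta> * \<delta> = of_int 0 * \<delta> - of_int (int N)" using N(3) by (simp add: power2_eq_square)
    have "integers_of K \<subseteq> lat 1 \<delta>"
    proof
      fix x assume "x \<in> integers_of K"
      from ints[OF this] obtain A B M where AB: "x = (of_int A + of_int B * \<delta>) / 2" "A\<^sup>2 + int N * B\<^sup>2 = 4 * M" .
      have "int N mod 4 = 1 \<or> int N mod 4 = 2" using N4 False by presburger
      hence "even A" "even B" using cong[OF AB(2)] by (auto simp: sq split: if_splits)
      then obtain k m where "A = 2 * k" "B = 2 * m" by (auto elim!: evenE)
      hence "x = of_int k * 1 + of_int m * \<delta>" by (simp add: AB(1) algebra_simps add_divide_distrib)
      thus "x \<in> lat 1 \<delta>" unfolding lat_def by blast
    qed
    thus ?thesis using that d2 N(5) intI[OF N(4) d2] imaginary_quadratic_field_span[OF K N(4,5)] by blast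
  qed
qed

text \<open>Two integral bases differ by an integer matrix of determinant 1 or -1, and squaring
  removes the sign. For the basis 1, w the value is (cnj w - w)^2, the discriminant of X^2 - t X +
  n.\<close>

lemma integral_basis_discriminant:
  assumes O: "integers_of K = lat 1 w" and w: "w * w = of_int t * w - of_int n" "Im w \<noteq> 0"
    and b: "integral_basis K w1 w2"
  shows "(w1 * cnj w2 - w2 * cnj w1)\<^sup>2 = of_int (t\<^sup>2 - 4 * n)"
proof -
  have O': "lat w1 w2 = lat 1 w"
    using b O by (simp only: integral_basis_def lat_def)
  have "w1 \<in> lat 1 w" "w2 \<in> lat 1 w"
    using lat_mem_left[of w1 w2] lat_mem_right[of w2 w1] by (simp_all only: O')
  then obtain a b c d where 1: "w1 = of_int a + of_int b * w" "w2 = of_int c + of_int d * w"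
    unfolding lat_iff mult_1_right by metis
  have "1 \<in> lat w1 w2" "w \<in> lat w1 w2"
    using lat_mem_left[of 1 w] lat_mem_right[of w 1] by (simp_all only: O')
  then obtain p q r s where
    2: "1 = of_int p * w1 + of_int q * w2" "w = of_int r * w1 + of_int s * w2"
    unfolding lat_iff by metis
  have coord: "i = 0 \<and> j = 0" if "of_int i + of_int j * w = 0" for i j :: int
  proof -
    have "Im (of_int i + of_int j * w) = 0" by (simp add: that)
    hence "j = 0" using w(2) by simp
    thus ?thesis using that by simp
  qed
  have "of_int (p * a + q * c - 1) + of_int (p * b + q * d) * w = (of_int p * w1 + of_int q * w2) - 1"
    by (simp add: 1 algebra_simps)
  hence h1: "of_int (p * a + q * c - 1) + of_int (p * b + q * d) * w = 0"
    by (simp only: flip: 2(1)) simp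
  have "of_int (r * a + s * c) + of_int (r * b + s * d - 1) * w = (of_int r * w1 + of_int s * w2) - w"
    by (simp add: 1 algebra_simps)
  hence h2: "of_int (r * a + s * c) + of_int (r * b + s * d - 1) * w = 0"
    by (simp only: flip: 2(2)) simp
  have pq: "p * a + q * c = 1" "p * b + q * d = 0" "r * a + s * c = 0" "r * b + s * d = 1"
    using coord[OF h1] coord[OF h2] by auto
  \<comment> \<open>Multiplicativity of the determinant for the two transition matrices, whose
    product is the identity.\<close>
  have "(p * s - q * r) * (a * d - b * c) = (p * a + q * c) * (r * b + s * d) - (p * b + q * d) * (r * a + s * c)"
    by (simp add: algebra_simps)
  hence "(p * s - q * r) * (a * d - b * c) = 1" by (simp add: pq)
  hence "a * d - b * c = 1 \<or> a * d - b * c = - 1"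
    unfolding zmult_eq_1_iff by blast
  hence det: "(a * d - b * c)\<^sup>2 = 1" by auto
  have Re: "of_int t = 2 * Re w" and Im: "of_int n = (Re w)\<^sup>2 + (Im w)\<^sup>2"
  proof -
    have Im: "Im (w * w) = Im (of_int t * w - of_int n)" and Re: "Re (w * w) = Re (of_int t * w - of_int n)"
      by (rule arg_cong[OF w(1)])+
    from Im show t: "of_int t = 2 * Re w" using w(2) by simp
    from Re show "of_int n = (Re w)\<^sup>2 + (Im w)\<^sup>2"
      by (simp add: power2_eq_square t)
  qed
  have "w1 * cnj w2 - w2 * cnj w1 = of_int (a * d - b * c) * (cnj w - w)"
    by (simp add: 1 algebra_simps)
  hence "(w1 * cnj w2 - w2 * cnj w1)\<^sup>2 = of_int ((a * d - b * c)\<^sup>2) * (cnj w - w)\<^sup>2"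
    by (simp add: power_mult_distrib)
  also have "\<dots> = (cnj w - w)\<^sup>2" by (simp add: det)
  also have "\<dots> = of_real (- 4 * (Im w)\<^sup>2)" by (simp add: complex_eq_iff power2_eq_square)
  also have "- 4 * (Im w)\<^sup>2 = of_int (t\<^sup>2 - 4 * n)" by (simp add: Re Im power2_eq_square)
  finally show ?thesis by simp
qed

lemma field_discriminant_eq:
  assumes O: "integers_of K = lat 1 w" and w: "w * w = of_int t * w - of_int n" "Im w \<noteq> 0"
  shows "field_discriminant K = t\<^sup>2 - 4 * n"
proof -
  have b: "integral_basis K 1 w"
    using O w(2) by (auto simp: integral_basis_def lat_def complex_eq_iff)
  show ?thesis
    unfolding field_discriminant_def
  proof (rule the_equality)
    show "\<exists>w1 w2. integral_basis K w1 w2 \<and> of_int (t\<^sup>2 - 4 * n) = (w1 * cnj w2 - w2 * cnj w1)\<^sup>2"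
      using b integral_basis_discriminant[OF O w b, symmetric] by blast
  next
    fix D assume "\<exists>w1 w2. integral_basis K w1 w2 \<and> of_int D = (w1 * cnj w2 - w2 * cnj w1)\<^sup>2"
    then obtain w1 w2 where "integral_basis K w1 w2" "of_int D = (w1 * cnj w2 - w2 * cnj w1)\<^sup>2"
      by blast
    hence "complex_of_int D = of_int (t\<^sup>2 - 4 * n)"
      using integral_basis_discriminant[OF O w] by simp
    thus "D = t\<^sup>2 - 4 * n" by (simp only: of_int_eq_iff)
  qed
qed

section \<open>Finite subgroups of complex tori\<close>

definition additive :: "complex set \<Rightarrow> bool" where
  "additive L \<longleftrightarrow> 0 \<in> L \<and> (\<forall>x\<in>L. \<forall>y\<in>L. x - y \<in> L)"

lemma additive_minus: "additive L \<Longrightarrow> x \<in> L \<Longrightarrow> - x \<in> L"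
  by (metis additive_def diff_0)

lemma additive_add: "additive L \<Longrightarrow> x \<in> L \<Longrightarrow> y \<in> L \<Longrightarrow> x + y \<in> L"
  by (metis additive_def additive_minus diff_minus_eq_add)

lemma additive_diff: "additive L \<Longrightarrow> x \<in> L \<Longrightarrow> y \<in> L \<Longrightarrow> x - y \<in> L"
  by (simp add: additive_def)

lemma coset_eq_iff:
  assumes "additive L"
  shows "L +>\<^bsub>complex_field\<^esub> x = L +>\<^bsub>complex_field\<^esub> y \<longleftrightarrow> x - y \<in> L"
proof
  assume "L +>\<^bsub>complex_field\<^esub> x = L +>\<^bsub>complex_field\<^esub> y"
  moreover have "x \<in> L +>\<^bsub>complex_field\<^esub> x"
    using assms by (force simp: complex_coset_eq additive_def)
  ultimately obtain w where "w \<in> L" "x = w + y" by (auto simp: complex_coset_eq)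
  thus "x - y \<in> L" by simp
next
  assume *: "x - y \<in> L"
  show "L +>\<^bsub>complex_field\<^esub> x = L +>\<^bsub>complex_field\<^esub> y"
  proof (intro equalityI subsetI)
    fix z assume "z \<in> L +>\<^bsub>complex_field\<^esub> x"
    then obtain u where "u \<in> L" "z = u + x" by (auto simp: complex_coset_eq)
    hence "u + (x - y) \<in> L" "z = (u + (x - y)) + y" using additive_add[OF assms _ *] by auto
    thus "z \<in> L +>\<^bsub>complex_field\<^esub> y" unfolding complex_coset_eq by blast
  next
    fix z assume "z \<in> L +>\<^bsub>complex_field\<^esub> y"
    then obtain u where "u \<in> L" "z = u + y" by (auto simp: complex_coset_eq)
    hence "u - (x - y) \<in> L" "z = (u - (x - y)) + x" using additive_diff[OF assms _ *] by auto
    thus "z \<in> L +>\<^bsub>complex_field\<^esub> x" unfolding complex_coset_eq by blast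
  qed
qed

lemma coset_self_iff:
  assumes "additive L"
  shows "L +>\<^bsub>complex_field\<^esub> x = L \<longleftrightarrow> x \<in> L"
  using coset_eq_iff[OF assms, of x 0] by (simp add: complex_coset_eq)

lemma one_complex_torus: "\<one>\<^bsub>complex_torus L\<^esub> = L"
  by (simp add: complex_torus_def FactGroup_def)

lemma carrier_complex_torus:
  "carrier (complex_torus L) = {L +>\<^bsub>complex_field\<^esub> z | z. True}"
  by (auto simp: complex_torus_def FactGroup_def RCOSETS_def a_r_coset_def complex_field_def)

lemma mult_complex_torus:
  assumes "additive L"
  shows "(L +>\<^bsub>complex_field\<^esub> x) \<otimes>\<^bsub>complex_torus L\<^esub> (L +>\<^bsub>complex_field\<^esub> y)
    = L +>\<^bsub>complex_field\<^esub> (x + y)"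
proof -
  have "(L +>\<^bsub>complex_field\<^esub> x) \<otimes>\<^bsub>complex_torus L\<^esub> (L +>\<^bsub>complex_field\<^esub> y)
     = {a + b | a b. a \<in> L +>\<^bsub>complex_field\<^esub> x \<and> b \<in> L +>\<^bsub>complex_field\<^esub> y}"
    by (auto simp: complex_torus_def FactGroup_def set_mult_def complex_field_def)
  also have "\<dots> = L +>\<^bsub>complex_field\<^esub> (x + y)"
  proof (intro equalityI subsetI)
    fix z assume "z \<in> {a + b | a b. a \<in> L +>\<^bsub>complex_field\<^esub> x \<and> b \<in> L +>\<^bsub>complex_field\<^esub> y}"
    then obtain u v where "u \<in> L" "v \<in> L" "z = (u + x) + (v + y)"
      by (auto simp: complex_coset_eq)
    hence "u + v \<in> L" "z = (u + v) + (x + y)" using additive_add[OF assms] by auto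
    thus "z \<in> L +>\<^bsub>complex_field\<^esub> (x + y)" unfolding complex_coset_eq by blast
  next
    fix z assume "z \<in> L +>\<^bsub>complex_field\<^esub> (x + y)"
    then obtain u where "u \<in> L" "z = (u + x) + (0 + y)" by (auto simp: complex_coset_eq)
    thus "z \<in> {a + b | a b. a \<in> L +>\<^bsub>complex_field\<^esub> x \<and> b \<in> L +>\<^bsub>complex_field\<^esub> y}"
      using assms unfolding complex_coset_eq additive_def by blast
  qed
  finally show ?thesis .
qed

text \<open>Isomorphisms are built from the concrete group \<open>G\<close> towards the torus
  subgroup \<open>H\<close>; turning them round relies on the group laws of \<open>G\<close>
  alone.\<close>

lemma is_iso_sym_hom:
  assumes "group G" "h \<in> iso G H"
  shows "H \<cong> G"
  using group.iso_set_sym[OF assms] by (auto simp: is_iso_def)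

text \<open>By \<open>rel\<close> the map i |-> i u + L has kernel A Z. For positive
  \<open>A\<close> the group \<open>integer_mod_group A\<close> lives on 0, ..., A - 1, so the
  homomorphism law comes down to invariance under reduction mod \<open>A\<close>
  (\<open>h_mod\<close>).\<close>

lemma torus_subgroup_iso_cyclic:
  assumes L: "additive L" and A: "0 < A"
    and rel: "\<And>i. of_int i * u \<in> L \<longleftrightarrow> int A dvd i"
    and C: "C = {L +>\<^bsub>complex_field\<^esub> (of_int i * u) | i. True}"
  shows "(complex_torus L)\<lparr>carrier := C\<rparr> \<cong> integer_mod_group A"
proof -
  define h where "h = (\<lambda>i. L +>\<^bsub>complex_field\<^esub> (of_int i * u))"
  have h_eq: "h i = h j \<longleftrightarrow> int A dvd i - j" for i j
    unfolding h_def coset_eq_iff[OF L] by (simp flip: rel add: algebra_simps)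
  have h_mod: "h (i mod int A) = h i" for i
    by (simp add: h_eq mod_eq_dvd_iff flip: mod_eq_dvd_iff)
  have "h \<in> iso (integer_mod_group A) ((complex_torus L)\<lparr>carrier := C\<rparr>)"
    unfolding iso_def mem_Collect_eq
  proof
    show "h \<in> hom (integer_mod_group A) ((complex_torus L)\<lparr>carrier := C\<rparr>)"
    proof (rule homI)
      fix i j
      have "h (i + j) = h i \<otimes>\<^bsub>complex_torus L\<^esub> h j"
        by (simp add: h_def mult_complex_torus[OF L] algebra_simps)
      thus "h (i \<otimes>\<^bsub>integer_mod_group A\<^esub> j) = h i \<otimes>\<^bsub>(complex_torus L)\<lparr>carrier := C\<rparr>\<^esub> h j"
        by (simp add: h_mod)
    qed (auto simp: C h_def)
    show "bij_betw h (carrier (integer_mod_group A)) (carrier ((complex_torus L)\<lparr>carrier := C\<rparr>))"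
      unfolding bij_betw_def
    proof
      show "inj_on h (carrier (integer_mod_group A))"
        using A by (auto simp: inj_on_def h_eq carrier_integer_mod_group simp flip: mod_eq_dvd_iff)
      have "h i \<in> h ` {0..<int A}" for i
        using A by (intro image_eqI[of _ _ "i mod int A"]) (simp_all add: h_mod)
      thus "h ` carrier (integer_mod_group A) = carrier ((complex_torus L)\<lparr>carrier := C\<rparr>)"
        using A by (auto simp: C carrier_integer_mod_group h_def)
    qed
  qed
  thus ?thesis by (rule is_iso_sym_hom[rotated]) simp
qed

text \<open>The relations of \<open>u\<close>, \<open>v\<close> modulo \<open>L\<close> have to form
  the diagonal lattice A Z x B Z; reaching this shape is the task of the adapted bases.\<close>

lemma torus_subgroup_iso_bicyclic:
  assumes L: "additive L" and A: "0 < A" and B: "0 < B"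
    and rel: "\<And>i j. of_int i * u + of_int j * v \<in> L \<longleftrightarrow> int A dvd i \<and> int B dvd j"
    and C: "C = {L +>\<^bsub>complex_field\<^esub> (of_int i * u + of_int j * v) | i j. True}"
  shows "(complex_torus L)\<lparr>carrier := C\<rparr> \<cong> integer_mod_group A \<times>\<times> integer_mod_group B"
proof -
  define h where "h = (\<lambda>(i, j). L +>\<^bsub>complex_field\<^esub> (of_int i * u + of_int j * v))"
  have h_eq: "h (i, j) = h (i', j') \<longleftrightarrow> int A dvd i - i' \<and> int B dvd j - j'" for i j i' j'
    unfolding h_def coset_eq_iff[OF L] prod.case by (simp flip: rel add: algebra_simps)
  have h_mod: "h (i mod int A, j mod int B) = h (i, j)" for i j
    by (simp add: h_eq flip: mod_eq_dvd_iff)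
  let ?Z = "integer_mod_group A \<times>\<times> integer_mod_group B"
  have "h \<in> iso ?Z ((complex_torus L)\<lparr>carrier := C\<rparr>)"
    unfolding iso_def mem_Collect_eq
  proof
    show "h \<in> hom ?Z ((complex_torus L)\<lparr>carrier := C\<rparr>)"
    proof (rule homI)
      fix x y :: "int \<times> int"
      have "h (i + i', j + j') = h (i, j) \<otimes>\<^bsub>complex_torus L\<^esub> h (i', j')" for i j i' j'
        by (simp add: h_def mult_complex_torus[OF L] algebra_simps)
      thus "h (x \<otimes>\<^bsub>?Z\<^esub> y) = h x \<otimes>\<^bsub>(complex_torus L)\<lparr>carrier := C\<rparr>\<^esub> h y"
        by (cases x; cases y) (simp add: h_mod DirProd_def)
    qed (auto simp: C h_def)
    show "bij_betw h (carrier ?Z) (carrier ((complex_torus L)\<lparr>carrier := C\<rparr>))"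
      unfolding bij_betw_def
    proof
      show "inj_on h (carrier ?Z)"
        using A B
        by (auto simp: inj_on_def h_eq carrier_integer_mod_group simp flip: mod_eq_dvd_iff)
      have "h (i, j) \<in> h ` ({0..<int A} \<times> {0..<int B})" for i j
        using A B by (intro image_eqI[of _ _ "(i mod int A, j mod int B)"]) (simp_all add: h_mod)
      thus "h ` carrier ?Z = carrier ((complex_torus L)\<lparr>carrier := C\<rparr>)"
        using A B by (auto simp: C carrier_integer_mod_group h_def)
    qed
  qed
  thus ?thesis by (rule is_iso_sym_hom[rotated]) (simp add: DirProd_group)
qed

section \<open>Inverses of the ideals over a prime\<close>

lemma additive_of_int_mult:
  assumes "additive M" "x \<in> M"
  shows "of_int i * x \<in> M"
proof -
  have nat: "of_nat k * x \<in> M" for k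
  proof (induction k)
    case 0
    show ?case using assms(1) by (simp add: additive_def)
  next
    case (Suc k)
    thus ?case using additive_add[OF assms(1) assms(2)] by (simp add: distrib_right)
  qed
  show ?thesis
  proof (cases "i \<ge> 0")
    case True
    thus ?thesis using nat[of "nat i"] by simp
  next
    case False
    thus ?thesis using additive_minus[OF assms(1) nat[of "nat (- i)"]] by simp
  qed
qed

text \<open>The integers \<open>i\<close> with \<open>i * x\<close> in \<open>M\<close> form an
  ideal of Z. In particular, coprime multipliers put \<open>x\<close> itself into
  \<open>M\<close>.\<close>

lemma additive_bezout:
  assumes "additive M" "of_int a * x \<in> M" "of_int b * x \<in> M"
  shows "of_int (gcd a b) * x \<in> M"
proof -
  obtain u v where "u * a + v * b = gcd a b" using bezout_int by blast
  hence "of_int (gcd a b) = (of_int u * of_int a + of_int v * of_int b :: complex)"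
    by (metis of_int_add of_int_mult)
  hence "of_int (gcd a b) * x = of_int u * (of_int a * x) + of_int v * (of_int b * x)"
    by (simp add: algebra_simps)
  thus ?thesis using additive_add additive_of_int_mult assms by simp
qed

lemma additive_lat: "additive (lat u v)"
  unfolding additive_def
proof (intro conjI ballI)
  show "0 \<in> lat u v" using lat_memI[of 0 u 0 v] by simp
  fix x y assume "x \<in> lat u v" "y \<in> lat u v"
  then obtain i j k l where "x = of_int i * u + of_int j * v" "y = of_int k * u + of_int l * v"
    unfolding lat_iff by metis
  hence "x - y = of_int (i - k) * u + of_int (j - l) * v" by (simp add: algebra_simps)
  thus "x - y \<in> lat u v" unfolding lat_iff by blast
qed

lemma lat_subset_iff:
  assumes "additive M"
  shows "lat u v \<subseteq> M \<longleftrightarrow> u \<in> M \<and> v \<in> M"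
proof
  show "lat u v \<subseteq> M \<Longrightarrow> u \<in> M \<and> v \<in> M"
    using lat_mem_left lat_mem_right by blast
  show "u \<in> M \<and> v \<in> M \<Longrightarrow> lat u v \<subseteq> M"
    using additive_add[OF assms] additive_of_int_mult[OF assms] by (auto simp: lat_iff)
qed

lemma lat_shift: "lat u (v + of_int k * u) = lat u v"
proof
  show "lat u (v + of_int k * u) \<subseteq> lat u v"
    using lat_memI[of k u 1 v] by (simp add: lat_subset_iff additive_lat lat_mem_left add.commute)
  show "lat u v \<subseteq> lat u (v + of_int k * u)"
    using lat_memI[of "- k" u 1 "v + of_int k * u"]
    by (simp add: lat_subset_iff additive_lat lat_mem_left)
qed

text \<open>As \<open>v\<close> is nonreal, 1 and \<open>v\<close> are linearly independent over the
  reals, so imaginary and real parts recover both coefficients. All relations among torsion points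
  are read off with this test.\<close>

lemma frac_mem_lat_iff:
  assumes "Im v \<noteq> 0" "d \<noteq> 0" "e \<noteq> 0"
  shows "of_int a / of_int d + of_int b / of_int e * v \<in> lat 1 v \<longleftrightarrow> d dvd a \<and> e dvd b"
proof
  assume "d dvd a \<and> e dvd b"
  then obtain i j where "a = d * i" "b = e * j" by blast
  hence "of_int a / of_int d + of_int b / of_int e * v = of_int i * 1 + of_int j * v"
    using assms by simp
  thus "of_int a / of_int d + of_int b / of_int e * v \<in> lat 1 v" unfolding lat_iff by blast
next
  assume "of_int a / of_int d + of_int b / of_int e * v \<in> lat 1 v"
  then obtain i j where ij: "of_int a / of_int d + of_int b / of_int e * v = of_int i * 1 + of_int j * v"
    unfolding lat_iff by blast
  have Im_frac: "Im (of_int x / of_int y) = 0" "Re (of_int x / of_int y) = of_int x / of_int y" for x y :: int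
    by (metis Im_complex_of_real of_real_divide of_real_of_int_eq,
        metis Re_complex_of_real of_real_divide of_real_of_int_eq)
  have "of_int b / of_int e * Im v = of_int j * Im v"
    using arg_cong[OF ij, of Im] by (simp add: Im_frac)
  hence b: "of_int b / of_int e = (of_int j :: real)" using assms(1) by (metis mult_cancel_right)
  have "of_int a / of_int d + of_int b / of_int e * Re v = of_int i + of_int j * Re v"
    using arg_cong[OF ij, of Re] by (simp add: Im_frac)
  hence a: "of_int a / of_int d = (of_int i :: real)" by (simp add: b)
  have "of_int b = (of_int (e * j) :: real)" "of_int a = (of_int (d * i) :: real)"
    using a b assms by (simp_all add: field_simps)
  thus "d dvd a \<and> e dvd b" by (simp only: of_int_eq_iff) simp
qed

text \<open>For the ring of integers \<open>M\<close> and a nonzero ideal \<open>I\<close> this is the fractional ideal \<open>I\<inverse>\<close>,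
  hence \<open>E'[I] = colon M I / M\<close>.  All these operators, including division by a scalar
  \<open>M \<mapsto> colon M {c}\<close>, commute.\<close>

definition colon :: "complex set \<Rightarrow> complex set \<Rightarrow> complex set" where
  "colon M I = {z. \<forall>x\<in>I. z * x \<in> M}"

lemma colon_commute: "colon (colon M I) J = colon (colon M J) I"
proof -
  have "colon (colon M I) J \<subseteq> colon (colon M J) I" for I J
  proof
    fix z assume z: "z \<in> colon (colon M I) J"
    have "z * x * y \<in> M" if "x \<in> I" "y \<in> J" for x y
    proof -
      have "z * y * x \<in> M" using z that by (simp add: colon_def)
      thus ?thesis by (simp add: ac_simps)
    qed
    thus "z \<in> colon (colon M J) I" by (simp add: colon_def)
  qed
  thus ?thesis by blast
qed

lemma additive_colon:
  assumes "additive M"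
  shows "additive (colon M I)"
  using assms by (auto simp: additive_def colon_def left_diff_distrib)

lemma colon_lat:
  assumes "additive M"
  shows "z \<in> colon M (lat u v) \<longleftrightarrow> z * u \<in> M \<and> z * v \<in> M"
proof
  show "z \<in> colon M (lat u v) \<Longrightarrow> z * u \<in> M \<and> z * v \<in> M"
    using lat_mem_left lat_mem_right by (auto simp: colon_def)
  assume *: "z * u \<in> M \<and> z * v \<in> M"
  have "z * (of_int i * u + of_int j * v) \<in> M" for i j
    using additive_add[OF assms additive_of_int_mult[OF assms, of "z * u" i]
        additive_of_int_mult[OF assms, of "z * v" j]] *
    by (simp add: algebra_simps)
  thus "z \<in> colon M (lat u v)" by (auto simp: colon_def lat_iff)
qed

text \<open>For fixed \<open>z\<close> the \<open>x\<close> with \<open>z * x\<close> in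
  \<open>M\<close> are closed under sums, so it suffices to test the generating products. This
  trades products of ideals for compositions of operators.\<close>

lemma colon_ideal_prod:
  assumes "additive M"
  shows "colon M (I \<cdot>\<^bsub>integer_ring K\<^esub> J) = colon (colon M I) J"
proof (intro equalityI subsetI)
  fix z assume z: "z \<in> colon M (I \<cdot>\<^bsub>integer_ring K\<^esub> J)"
  have "z * y * x \<in> M" if "x \<in> I" "y \<in> J" for x y
  proof -
    have "x * y \<in> I \<cdot>\<^bsub>integer_ring K\<^esub> J"
      using ideal_prod.prod[OF that, of "integer_ring K"]
      by (simp add: integer_ring_def complex_field_def)
    hence "z * (x * y) \<in> M" using z by (simp add: colon_def)
    thus ?thesis by (simp add: ac_simps)
  qed
  thus "z \<in> colon (colon M I) J" by (simp add: colon_def)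
next
  fix z assume z: "z \<in> colon (colon M I) J"
  have "z * x \<in> M" if "x \<in> I \<cdot>\<^bsub>integer_ring K\<^esub> J" for x
    using that
  proof (induction rule: ideal_prod.induct)
    case (prod i j)
    hence "z * j * i \<in> M" using z by (simp add: colon_def)
    thus ?case by (simp add: integer_ring_def complex_field_def ac_simps)
  next
    case (sum x y)
    thus ?case using additive_add[OF assms, of "z * x" "z * y"]
      by (simp add: integer_ring_def complex_field_def distrib_left)
  qed
  thus "z \<in> colon M (I \<cdot>\<^bsub>integer_ring K\<^esub> J)" by (simp add: colon_def)
qed

text \<open>On O_K-modules this is \<open>colon\<close> by the k-th ideal power
  (\<open>colon_ideal_power\<close>); the iterated form allows single factors to be
  commuted.\<close>

definition colon_power :: "complex set \<Rightarrow> nat \<Rightarrow> complex set \<Rightarrow> complex set" where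
  "colon_power P k M = ((\<lambda>M. colon M P) ^^ k) M"

lemma colon_power_0 [simp]: "colon_power P 0 M = M"
  by (simp add: colon_power_def)

lemma colon_power_Suc: "colon_power P (Suc k) M = colon (colon_power P k M) P"
  by (simp add: colon_power_def)

lemma colon_power_colon: "colon_power P k (colon M Q) = colon (colon_power P k M) Q"
proof (induction k)
  case (Suc k)
  thus ?case by (simp add: colon_power_Suc colon_commute)
qed simp

lemma colon_power_Suc': "colon_power P (Suc k) M = colon_power P k (colon M P)"
  by (simp add: colon_power_Suc colon_power_colon)

lemma colon_power_scale_lat:
  assumes "c \<noteq> 0"
  shows "colon_power {c} k (lat u v) = lat (u / c ^ k) (v / c ^ k)"
proof (induction k)
  case (Suc k)
  have "colon (lat (u / c ^ k) (v / c ^ k)) {c} = lat (u / c ^ Suc k) (v / c ^ Suc k)"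
  proof -
    have "z * c = of_int i * (u / c ^ k) + of_int j * (v / c ^ k) \<longleftrightarrow>
        z = of_int i * (u / c ^ Suc k) + of_int j * (v / c ^ Suc k)" for z i j
      using assms by (auto simp: field_simps)
    thus ?thesis by (simp add: set_eq_iff colon_def lat_iff)
  qed
  thus ?case by (simp add: colon_power_Suc Suc.IH)
qed simp

text \<open>A locale, because the same facts are instantiated for \<open>w\<close> and for several
  translates \<open>w - s\<close>. The parameters \<open>t\<close> and \<open>n\<close> are trace
  and norm of the generator.\<close>

locale quadratic_integers =
  fixes w :: complex and t n :: int
  assumes w_sq: "w * w = of_int t * w - of_int n" and w_im: "Im w \<noteq> 0"
begin

text \<open>The Z[w]-submodules of the complex numbers; closure under differences and under
  \<open>w\<close> already gives closure under the whole ring.\<close>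

definition stable :: "complex set \<Rightarrow> bool" where
  "stable M \<longleftrightarrow> additive M \<and> (\<forall>x\<in>M. w * x \<in> M)"

lemma stable_additive: "stable M \<Longrightarrow> additive M"
  by (simp add: stable_def)

lemma stable_mult:
  assumes "stable M" "y \<in> lat 1 w" "x \<in> M"
  shows "x * y \<in> M"
proof -
  obtain i j where "y = of_int i * 1 + of_int j * w" using assms(2) unfolding lat_iff by blast
  hence "x * y = of_int i * x + of_int j * (w * x)" by (simp add: algebra_simps)
  thus ?thesis
    using assms(1,3) by (simp add: stable_def additive_add additive_of_int_mult)
qed

lemma stable_integers: "stable (lat 1 w)"
  unfolding stable_def
proof (intro conjI ballI)
  fix x assume "x \<in> lat 1 w"
  then obtain i j where x: "x = of_int i * 1 + of_int j * w" unfolding lat_iff by blast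
  have "w * x = of_int i * w + of_int j * (w * w)" by (simp add: x algebra_simps)
  also have "\<dots> = of_int (- j * n) * 1 + of_int (i + j * t) * w"
    by (simp add: w_sq algebra_simps)
  finally show "w * x \<in> lat 1 w" unfolding lat_iff by blast
qed (rule additive_lat)

lemma stable_colon: "stable M \<Longrightarrow> stable (colon M I)"
  by (auto simp: stable_def additive_colon) (auto simp: colon_def mult.assoc)

lemma colon_integers:
  assumes "stable M"
  shows "colon M (lat 1 w) = M"
  using stable_mult[OF assms] lat_mem_left[of 1 w] by (force simp: colon_def)

lemma colon_ideal_power:
  assumes "stable M" "integers_of K = lat 1 w"
  shows "colon M (ideal_power K P k) = colon_power P k M"
proof (induction k)
  case 0
  \<comment> \<open>The zeroth ideal power is the whole ring.\<close>
  show ?case using colon_integers[OF assms(1)]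
    by (simp add: nat_pow_def ideals_set_def integer_ring_def assms(2))
next
  case (Suc k)
  have "ideal_power K P (Suc k) = ideal_power K P k \<cdot>\<^bsub>integer_ring K\<^esub> P"
    by (simp add: nat_pow_def ideals_set_def)
  thus ?case
    by (simp add: colon_ideal_prod[OF stable_additive[OF assms(1)]] Suc.IH colon_power_Suc)
qed

text \<open>The new norm is the minimal polynomial X^2 - t X + n evaluated at \<open>s\<close>.
  Hence a root \<open>s\<close> modulo \<open>l\<close> yields a generator whose norm is divisible
  by \<open>l\<close>.\<close>

lemma shift:
  "quadratic_integers (w - of_int s) (t - 2 * s) (s\<^sup>2 - t * s + n)"
  "lat 1 (w - of_int s) = lat 1 w"
proof -
  have "(w - of_int s) * (w - of_int s) = w * w - 2 * of_int s * w + of_int s * of_int s"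
    by (simp add: algebra_simps)
  also have "\<dots> = of_int (t - 2 * s) * (w - of_int s) - of_int (s\<^sup>2 - t * s + n)"
    by (simp add: w_sq algebra_simps power2_eq_square)
  finally show "quadratic_integers (w - of_int s) (t - 2 * s) (s\<^sup>2 - t * s + n)"
    using w_im by unfold_locales simp_all
  show "lat 1 (w - of_int s) = lat 1 w"
    using lat_shift[of 1 w "- s"] by simp
qed

text \<open>The generator \<open>w\<close> is normalised below so that \<open>l\<close> divides its norm \<open>n\<close>.  The primes over \<open>l\<close> are
  then \<open>(l, w)\<close> and \<open>(l, w - t)\<close>, and they coincide iff \<open>l\<close> divides \<open>t\<close>.\<close>

lemma colon_split_pair:
  assumes M: "stable M" and l: "prime l" "l dvd n" "\<not> l dvd t"
  shows "colon (colon M (lat (of_int l) w)) (lat (of_int l) (w - of_int t)) = colon M {of_int l}"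
proof (intro equalityI subsetI)
  note add = stable_additive[OF M]
  fix z assume "z \<in> colon (colon M (lat (of_int l) w)) (lat (of_int l) (w - of_int t))"
  hence "z * of_int l * of_int l \<in> M" "z * of_int l * w \<in> M" "z * (w - of_int t) * of_int l \<in> M"
    by (simp_all add: colon_lat add additive_colon)
  \<comment> \<open>The generators l w and l (w - t) of the product ideal differ by t l. Together
    with l^2, and \<open>t\<close> prime to \<open>l\<close>, this yields l itself.\<close>
  moreover have "of_int t * (z * of_int l) = z * of_int l * w - z * (w - of_int t) * of_int l"
    by (simp add: algebra_simps)
  ultimately have "of_int t * (z * of_int l) \<in> M" "of_int l * (z * of_int l) \<in> M"
    using additive_diff[OF add] by (simp_all add: ac_simps)
  moreover have "gcd t l = 1"
    using l prime_imp_coprime[of l t] by (simp add: coprime_iff_gcd_eq_1 gcd.commute)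
  ultimately show "z \<in> colon M {of_int l}"
    using additive_bezout[OF add, of t "z * of_int l" l] by (simp add: colon_def)
next
  note add = stable_additive[OF M]
  fix z assume "z \<in> colon M {of_int l}"
  hence z: "z * of_int l \<in> M" by (simp add: colon_def)
  obtain m where m: "n = l * m" using l by blast
  have "z * of_int l * of_int l \<in> M" "z * of_int l * w \<in> M" "z * of_int l * (w - of_int t) \<in> M"
    using stable_mult[OF M _ z] lat_memI[of l 1 0 w] lat_mem_right[of w 1] lat_memI[of "- t" 1 1 w]
    by simp_all
  \<comment> \<open>The remaining generator w (w - t) = -n of the product ideal is a multiple of
    l.\<close>
  moreover have "z * (w - of_int t) * w = of_int (- m) * (z * of_int l)"
  proof -
    have "z * (w - of_int t) * w = z * (w * w) - z * of_int t * w" by (simp add: algebra_simps)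
    also have "\<dots> = - (z * of_int n)" by (simp add: w_sq algebra_simps)
    finally show ?thesis by (simp add: m)
  qed
  ultimately show "z \<in> colon (colon M (lat (of_int l) w)) (lat (of_int l) (w - of_int t))"
    using additive_of_int_mult[OF add z, of "- m"] by (simp add: colon_lat add additive_colon ac_simps)
qed

text \<open>Operator form of P1^a P2^(a+k) = (l)^a P2^k. Each step trades one pair for a division by
  \<open>l\<close>, which is moved into \<open>M\<close>; hence \<open>M\<close> is arbitrary in the
  induction.\<close>

lemma colon_power_split_pair:
  assumes "stable M" "prime l" "l dvd n" "\<not> l dvd t"
  shows "colon_power (lat (of_int l) (w - of_int t)) (a + k) (colon_power (lat (of_int l) w) a M)
    = colon_power {of_int l} a (colon_power (lat (of_int l) (w - of_int t)) k M)"
  using assms(1)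
proof (induction a arbitrary: M)
  case (Suc a)
  have "colon_power (lat (of_int l) (w - of_int t)) (Suc a + k) (colon_power (lat (of_int l) w) (Suc a) M)
    = colon_power (lat (of_int l) (w - of_int t)) (a + k)
        (colon_power (lat (of_int l) w) a (colon (colon M (lat (of_int l) w)) (lat (of_int l) (w - of_int t))))"
    by (simp add: colon_power_Suc colon_power_colon colon_commute[of _ _ "lat (of_int l) w"])
  also have "\<dots> = colon_power {of_int l} a (colon_power (lat (of_int l) (w - of_int t)) k (colon M {of_int l}))"
    unfolding colon_split_pair[OF Suc.prems assms(2-4)]
    by (rule Suc.IH) (rule stable_colon[OF Suc.prems])
  also have "\<dots> = colon_power {of_int l} (Suc a) (colon_power (lat (of_int l) (w - of_int t)) k M)"
    by (simp add: colon_power_Suc colon_power_colon)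
  finally show ?case .
qed simp

text \<open>The approximate root \<open>r\<close> lifts the root 0 modulo \<open>l\<close>, where
  the derivative -t of X^2 - t X + n is a unit.\<close>

lemma hensel_step:
  assumes l: "prime l" "\<not> l dvd t" and r: "l dvd r" "l ^ Suc k dvd r\<^sup>2 - t * r + n"
  shows "\<exists>r'. l ^ Suc k dvd r' - r \<and> l ^ Suc (Suc k) dvd r'\<^sup>2 - t * r' + n"
proof -
  obtain m where m: "r\<^sup>2 - t * r + n = l ^ Suc k * m" using r(2) by blast
  have "\<not> l dvd 2 * r - t" using l(2) r(1) by (metis dvd_diff_right_iff dvd_mult)
  hence "coprime (2 * r - t) l" using prime_imp_coprime[OF l(1)] coprime_commute by blast
  then obtain u where u: "[(2 * r - t) * u = 1] (mod l)" using cong_solve_coprime_int by blast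
  \<comment> \<open>A Newton step: \<open>m * l ^ Suc k\<close> is the value of the polynomial at
    \<open>r\<close>, and \<open>u\<close> inverts its derivative 2 r - t modulo
    \<open>l\<close>.\<close>
  define r' where "r' = r - m * u * l ^ Suc k"
  have "r'\<^sup>2 - t * r' + n = (r\<^sup>2 - t * r + n) - (2 * r - t) * u * m * l ^ Suc k + (m * u * l ^ Suc k)\<^sup>2"
    by (simp add: r'_def power2_eq_square algebra_simps)
  also have "\<dots> = l ^ Suc k * (m * (1 - (2 * r - t) * u)) + l ^ Suc (Suc k) * (l ^ k * (m * u)\<^sup>2)"
    unfolding m by (simp add: power2_eq_square algebra_simps)
  finally have eq: "r'\<^sup>2 - t * r' + n = l ^ Suc k * (m * (1 - (2 * r - t) * u)) + l ^ Suc (Suc k) * (l ^ k * (m * u)\<^sup>2)" .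
  have "l dvd 1 - (2 * r - t) * u" using u by (metis cong_iff_dvd_diff cong_sym)
  hence "l ^ Suc k * l dvd l ^ Suc k * (m * (1 - (2 * r - t) * u))" by (intro mult_dvd_mono dvd_mult) auto
  hence "l ^ Suc (Suc k) dvd r'\<^sup>2 - t * r' + n" unfolding eq by (intro dvd_add) (simp_all add: mult.commute)
  moreover have "l ^ Suc k dvd r' - r" by (simp add: r'_def)
  ultimately show ?thesis by blast
qed

text \<open>With v = (w - r) / l^k the product of v / l and w - t is an integral combination of 1
  and v because \<open>r\<close> is a root modulo l^(k+1). This is why the root is always known to
  one power of \<open>l\<close> more than the denominator already reached.\<close>

lemma colon_split_step:
  assumes l: "prime l" "\<not> l dvd t" and r: "l dvd r" "l ^ Suc k dvd r\<^sup>2 - t * r + n"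
  shows "colon (lat 1 ((w - of_int r) / of_int l ^ k)) (lat (of_int l) (w - of_int t))
    = lat 1 ((w - of_int r) / of_int l ^ Suc k)"
proof (intro equalityI subsetI)
  define v where "v = (w - of_int r) / of_int l ^ k"
  have l0: "l \<noteq> 0" using l(1) by auto
  have w: "w = of_int (l ^ k) * v + of_int r" using l0 by (simp add: v_def)
  have v_im: "Im v \<noteq> 0"
  proof
    assume "Im v = 0"
    hence "Im w = 0" unfolding w by simp
    thus False using w_im by simp
  qed
  obtain q where q: "r\<^sup>2 - t * r + n = l ^ Suc k * q" using r(2) by blast
  obtain s where s: "r = l * s" using r(1) by blast
  have v_eq: "(w - of_int r) / of_int l ^ Suc k = v / of_int l" by (simp add: v_def)
  have key: "v / of_int l * (w - of_int t) = of_int (- q) * 1 + of_int (- s) * v"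
  proof -
    have "(w - of_int r) * (w - of_int t) = - of_int (r\<^sup>2 - t * r + n) - of_int r * (w - of_int r)"
      using w_sq by (simp add: algebra_simps power2_eq_square)
    also have "\<dots> = of_int (l ^ Suc k) * (of_int (- q) * 1 + of_int (- s) * v)"
      unfolding q using l0 by (simp add: w s algebra_simps)
    finally have "(w - of_int r) * (w - of_int t) / of_int l ^ Suc k = of_int (- q) * 1 + of_int (- s) * v"
      using l0 by (simp add: field_simps)
    thus ?thesis unfolding v_eq[symmetric] by simp
  qed
  have wt: "w - of_int t = of_int (r - t) * 1 + of_int (l ^ k) * v" using w by simp
  have one: "w - of_int t \<in> lat 1 v" unfolding wt by (rule lat_memI)
  have two: "v / of_int l * (w - of_int t) \<in> lat 1 v" unfolding key by (rule lat_memI)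
  fix z
  {
    assume "z \<in> lat 1 ((w - of_int r) / of_int l ^ Suc k)"
    then obtain i j where z: "z = of_int i + of_int j * (v / of_int l)"
      unfolding lat_iff v_eq by auto
    have "z * of_int l = of_int (i * l) * 1 + of_int j * v" using l0 by (simp add: z algebra_simps)
    hence "z * of_int l \<in> lat 1 v" by (metis lat_memI)
    moreover have "z * (w - of_int t) = of_int i * (w - of_int t) + of_int j * (v / of_int l * (w - of_int t))"
      by (simp add: z algebra_simps)
    hence "z * (w - of_int t) \<in> lat 1 v"
      using one two by (metis additive_add additive_lat additive_of_int_mult)
    ultimately show "z \<in> colon (lat 1 ((w - of_int r) / of_int l ^ k)) (lat (of_int l) (w - of_int t))"
      by (simp add: colon_lat additive_lat flip: v_def)
  next
    assume "z \<in> colon (lat 1 ((w - of_int r) / of_int l ^ k)) (lat (of_int l) (w - of_int t))"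
    hence zl: "z * of_int l \<in> lat 1 v" and zw: "z * (w - of_int t) \<in> lat 1 v"
      by (simp_all add: colon_lat additive_lat flip: v_def)
    from zl obtain i j where "z * of_int l = of_int i * 1 + of_int j * v" unfolding lat_iff by blast
    hence z: "z = of_int i / of_int l + of_int j * (v / of_int l)" using l0 by (simp add: field_simps)
    \<comment> \<open>Once the multiple of v / l is removed, the constant coefficient i (r - t) / l
      has to be an integer, and \<open>l\<close> does not divide r - t.\<close>
    have "of_int i / of_int l * (w - of_int t) = z * (w - of_int t) - of_int j * (v / of_int l * (w - of_int t))"
      by (simp add: z algebra_simps)
    hence "of_int i / of_int l * (w - of_int t) \<in> lat 1 v"
      using zw two by (metis additive_diff additive_lat additive_of_int_mult)
    moreover have "of_int i / of_int l * (w - of_int t) =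
        of_int (i * (r - t)) / of_int l + of_int (i * l ^ k) / of_int l * v"
      unfolding wt by (simp add: algebra_simps diff_divide_distrib)
    ultimately have "l dvd i * (r - t)" using frac_mem_lat_iff[OF v_im l0 l0] by metis
    moreover have "\<not> l dvd r - t" using l(2) r(1) by (metis dvd_diff_right_iff)
    ultimately have "l dvd i" using l(1) prime_dvd_mult_iff by blast
    then obtain m where "i = l * m" by blast
    hence "z = of_int m * 1 + of_int j * (v / of_int l)" using l0 by (simp add: z)
    thus "z \<in> lat 1 ((w - of_int r) / of_int l ^ Suc k)" unfolding v_eq by (metis lat_memI)
  }
qed

text \<open>The root depends on \<open>k\<close>: the induction starts from the root 0 modulo
  \<open>l\<close> and carries the precision l^(k+1) that the next step consumes.\<close>

lemma colon_power_split:
  assumes l: "prime l" "\<not> l dvd t" "l dvd n"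
  shows "\<exists>r. colon_power (lat (of_int l) (w - of_int t)) k (lat 1 w) = lat 1 ((w - of_int r) / of_int l ^ k)
    \<and> l dvd r \<and> l ^ Suc k dvd r\<^sup>2 - t * r + n"
proof (induction k)
  case 0
  show ?case using l(3) by (intro exI[of _ 0]) simp
next
  case (Suc k)
  then obtain r where r: "colon_power (lat (of_int l) (w - of_int t)) k (lat 1 w) = lat 1 ((w - of_int r) / of_int l ^ k)"
    "l dvd r" "l ^ Suc k dvd r\<^sup>2 - t * r + n" by blast
  obtain r' where r': "l ^ Suc k dvd r' - r" "l ^ Suc (Suc k) dvd r'\<^sup>2 - t * r' + n"
    using hensel_step[OF l(1,2) r(2,3)] by blast
  have "l dvd r' - r" using r'(1) by (metis dvd_mult_left power_Suc)
  hence lr': "l dvd r'" using r(2) dvd_add[of l "r' - r" r] by simp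
  have l0: "l \<noteq> 0" using l(1) by auto
  obtain m where "r' - r = l ^ Suc k * m" using r'(1) by blast
  \<comment> \<open>Refining the root by a multiple of l^(k+1) translates the second generator by an
    integer, so the lattice with denominator l^k stays the same.\<close>
  hence "(w - of_int r) / of_int l ^ k = (w - of_int r') / of_int l ^ k + of_int (l * m) * 1"
  proof -
    have "r = r' - l ^ k * (l * m)" using \<open>r' - r = l ^ Suc k * m\<close> by (simp add: algebra_simps)
    hence "w - of_int r = (w - of_int r') + of_int l ^ k * of_int (l * m)" by simp
    thus ?thesis using l0 by (simp add: field_simps)
  qed
  hence "lat 1 ((w - of_int r) / of_int l ^ k) = lat 1 ((w - of_int r') / of_int l ^ k)"
    using lat_shift[of 1 "(w - of_int r') / of_int l ^ k" "l * m"] by simp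
  moreover have "l ^ Suc k dvd r'\<^sup>2 - t * r' + n" using r'(2) by (metis dvd_mult_right power_Suc)
  ultimately have "colon_power (lat (of_int l) (w - of_int t)) (Suc k) (lat 1 w) = lat 1 ((w - of_int r') / of_int l ^ Suc k)"
    using colon_split_step[OF l(1,2) lr', of k] by (simp only: colon_power_Suc r(1))
  thus ?case using lr' r'(2) by blast
qed

text \<open>The cancelled pairs contribute the common denominator l^a, the b - a surplus factors the
  additional denominator of the second generator.\<close>

lemma colon_split:
  assumes l: "prime l" "\<not> l dvd t" "l dvd n" and "a \<le> b"
  shows "\<exists>r. colon_power (lat (of_int l) (w - of_int t)) b (colon_power (lat (of_int l) w) a (lat 1 w))
    = lat (1 / of_int l ^ a) ((w - of_int r) / of_int l ^ b)"
proof -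
  obtain k where b: "b = a + k" using \<open>a \<le> b\<close> le_Suc_ex by blast
  obtain r where r: "colon_power (lat (of_int l) (w - of_int t)) k (lat 1 w) = lat 1 ((w - of_int r) / of_int l ^ k)"
    using colon_power_split[OF l] by blast
  have "of_int l \<noteq> (0 :: complex)" using l(1) by auto
  thus ?thesis
    unfolding b colon_power_split_pair[OF stable_integers l(1,3,2)] r
    by (intro exI[of _ r]) (simp add: colon_power_scale_lat power_add mult.commute)
qed

text \<open>Since \<open>l\<close> divides \<open>t\<close>, the relation w^2 = t w - n turns the
  generators l^2, l w, w^2 of the square into l^2, l w, n. As \<open>l\<close> divides
  \<open>n\<close> exactly once, gcd(n, l^2) = l.\<close>

lemma colon_ramified_square:
  assumes M: "stable M" and l: "prime l" "l dvd t" "l dvd n" "\<not> l\<^sup>2 dvd n"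
  shows "colon (colon M (lat (of_int l) w)) (lat (of_int l) w) = colon M {of_int l}"
proof (intro equalityI subsetI)
  note add = stable_additive[OF M]
  fix z assume "z \<in> colon (colon M (lat (of_int l) w)) (lat (of_int l) w)"
  hence z: "z * of_int l * of_int l \<in> M" "z * of_int l * w \<in> M" "z * w * w \<in> M"
    by (simp_all add: colon_lat add additive_colon)
  obtain u where u: "t = l * u" using l by blast
  have "of_int n * z = of_int u * (z * of_int l * w) - z * w * w"
    using w_sq by (simp add: mult.assoc) (simp add: u algebra_simps)
  hence "of_int n * z \<in> M" using z(2,3) additive_diff[OF add] additive_of_int_mult[OF add] by simp
  moreover have "of_int (l\<^sup>2) * z \<in> M" using z(1) by (simp add: power2_eq_square ac_simps)
  moreover have "gcd n (l\<^sup>2) = l"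
  proof -
    obtain m where m: "n = l * m" using l by blast
    have "\<not> l dvd m" using l(4) unfolding m power2_eq_square by (metis dvd_refl mult_dvd_mono)
    hence "gcd m l = 1" using l(1) prime_imp_coprime[of l m]
      by (simp add: coprime_iff_gcd_eq_1 gcd.commute)
    moreover have "gcd n (l\<^sup>2) = \<bar>l\<bar> * gcd m l" unfolding m power2_eq_square by (simp add: gcd_mult_distrib_int)
    ultimately show ?thesis using l(1) by (simp add: prime_ge_0_int)
  qed
  ultimately show "z \<in> colon M {of_int l}"
    using additive_bezout[OF add, of n z "l\<^sup>2"] by (simp add: colon_def ac_simps)
next
  note add = stable_additive[OF M]
  fix z assume "z \<in> colon M {of_int l}"
  hence z: "z * of_int l \<in> M" by (simp add: colon_def)
  obtain u where u: "t = l * u" using l by blast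
  obtain m where m: "n = l * m" using l by blast
  have *: "z * of_int l * of_int l \<in> M" "z * of_int l * w \<in> M"
    using stable_mult[OF M _ z] lat_memI[of l 1 0 w] lat_mem_right[of w 1] by simp_all
  have "z * w * w = of_int u * (z * of_int l * w) - of_int m * (z * of_int l)"
    using w_sq by (simp add: mult.assoc) (simp add: u m algebra_simps)
  hence "z * w * w \<in> M" using z * additive_diff[OF add] additive_of_int_mult[OF add] by simp
  thus "z \<in> colon (colon M (lat (of_int l) w)) (lat (of_int l) w)"
    using * by (simp add: colon_lat add additive_colon ac_simps)
qed

text \<open>This is the factor left over for odd exponents; w / l is admissible because w^2 / l = (t
  / l) w - n / l is integral.\<close>

lemma colon_ramified:
  assumes l: "prime l" "l dvd t" "l dvd n"
  shows "colon (lat 1 w) (lat (of_int l) w) = lat 1 (w / of_int l)"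
proof (intro equalityI subsetI)
  have l0: "l \<noteq> 0" using l(1) by auto
  obtain u where u: "t = l * u" using l by blast
  obtain m where m: "n = l * m" using l by blast
  have key: "w / of_int l * w = of_int (- m) * 1 + of_int u * w"
    using w_sq l0 by (simp add: u m field_simps)
  have two: "w / of_int l * w \<in> lat 1 w" unfolding key by (rule lat_memI)
  fix z
  {
    assume "z \<in> lat 1 (w / of_int l)"
    then obtain i j where z: "z = of_int i + of_int j * (w / of_int l)"
      unfolding lat_iff by auto
    have "z * of_int l = of_int (i * l) * 1 + of_int j * w" using l0 by (simp add: z algebra_simps)
    hence "z * of_int l \<in> lat 1 w" by (metis lat_memI)
    moreover have "z * w = of_int i * w + of_int j * (w / of_int l * w)"
      by (simp add: z algebra_simps)
    hence "z * w \<in> lat 1 w"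
      using lat_mem_right two by (metis additive_add additive_lat additive_of_int_mult)
    ultimately show "z \<in> colon (lat 1 w) (lat (of_int l) w)"
      by (simp add: colon_lat additive_lat)
  next
    assume "z \<in> colon (lat 1 w) (lat (of_int l) w)"
    hence zl: "z * of_int l \<in> lat 1 w" and zw: "z * w \<in> lat 1 w"
      by (simp_all add: colon_lat additive_lat)
    from zl obtain i j where "z * of_int l = of_int i * 1 + of_int j * w" unfolding lat_iff by blast
    hence z: "z = of_int i / of_int l + of_int j * (w / of_int l)" using l0 by (simp add: field_simps)
    \<comment> \<open>Multiplication by \<open>w\<close> moves i / l to the second coordinate, so
      here the coefficient of \<open>w\<close> forces \<open>l\<close> to divide
      \<open>i\<close>.\<close>
    have "of_int 0 / of_int 1 + of_int i / of_int l * w = z * w - of_int j * (w / of_int l * w)"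
      by (simp add: z algebra_simps)
    hence "of_int 0 / of_int 1 + of_int i / of_int l * w \<in> lat 1 w"
      using zw two by (metis additive_diff additive_lat additive_of_int_mult)
    hence "l dvd i" using frac_mem_lat_iff[OF w_im _ l0, of 1 0 i] by simp
    then obtain m where "i = l * m" by blast
    hence "z = of_int m * 1 + of_int j * (w / of_int l)" using l0 by (simp add: z)
    thus "z \<in> lat 1 (w / of_int l)" by (metis lat_memI)
  }
qed

text \<open>A pair of factors divides both coordinates by \<open>l\<close>, while a leftover factor
  affects only the second; so the exponents are the floor and the ceiling of d/2.\<close>

lemma colon_power_ramified:
  assumes l: "prime l" "l dvd t" "l dvd n" "\<not> l\<^sup>2 dvd n"
  shows "colon_power (lat (of_int l) w) d (lat 1 w)
    = lat (1 / of_int l ^ (d div 2)) (w / of_int l ^ ((d + 1) div 2))"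
proof -
  have even: "colon_power (lat (of_int l) w) (2 * k) M = colon_power {of_int l} k M" if "stable M" for k M
    using that
  proof (induction k arbitrary: M)
    case (Suc k)
    have "colon_power (lat (of_int l) w) (2 * Suc k) M
        = colon_power (lat (of_int l) w) (2 * k) (colon (colon M (lat (of_int l) w)) (lat (of_int l) w))"
      by (simp add: colon_power_Suc')
    also have "\<dots> = colon_power {of_int l} (Suc k) M"
      unfolding colon_ramified_square[OF Suc.prems l] colon_power_Suc'
      by (rule Suc.IH) (rule stable_colon[OF Suc.prems])
    finally show ?case .
  qed simp
  have l0: "of_int l \<noteq> (0 :: complex)" using l(1) by auto
  show ?thesis
  proof (cases "even d")
    case True
    then obtain k where "d = 2 * k" by blast
    thus ?thesis using l0 by (simp add: even[OF stable_integers] colon_power_scale_lat)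
  next
    case False
    then obtain k where "d = Suc (2 * k)" by (auto elim: oddE)
    moreover have "colon_power (lat (of_int l) w) (Suc (2 * k)) (lat 1 w)
        = lat (1 / of_int l ^ k) (w / of_int l / of_int l ^ k)"
      using l0 by (simp only: colon_power_Suc' even[OF stable_colon[OF stable_integers]])
        (simp only: colon_ramified[OF l(1-3)] colon_power_scale_lat[OF l0])
    ultimately show ?thesis by (simp add: mult.commute)
  qed
qed

text \<open>As w (w - t) = -n lies in \<open>P\<close>, primality puts \<open>w\<close> or
  \<open>w - t\<close> into \<open>P\<close>, which then contains one of the two ideals. It is no
  larger, since an integer in \<open>P\<close> prime to \<open>l\<close> would give 1 in
  \<open>P\<close> by Bezout.\<close>

lemma primes_over_cases:
  assumes O: "integers_of K = lat 1 w" and l: "prime (int l)" "int l dvd n" and P: "P \<in> primes_over K l"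
  shows "P = lat (of_nat l) w \<or> P = lat (of_nat l) (w - of_int t)"
proof -
  have P': "primeideal P (integer_ring K)" and lP: "of_nat l \<in> P"
    using P by (auto simp: primes_over_def)
  interpret primeideal P "integer_ring K" by (rule P')
  have simps: "carrier (integer_ring K) = lat 1 w" "mult (integer_ring K) = (*)"
    "add (integer_ring K) = (+)" "zero (integer_ring K) = 0" "one (integer_ring K) = 1"
    by (simp_all add: integer_ring_def complex_field_def O)
  have sub: "P \<subseteq> lat 1 w" using a_subset by (simp add: simps)
  have mult: "x * y \<in> P" if "x \<in> P" "y \<in> lat 1 w" for x y
    using I_r_closed[of x y] that by (simp add: simps)
  have plus: "x + y \<in> P" if "x \<in> P" "y \<in> P" for x y
    using additive_subgroup.a_closed[OF is_additive_subgroup, of x y] that by (simp add: simps)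
  have int: "of_int i \<in> lat 1 w" for i using lat_memI[of i 1 0 w] by simp
  have "0 \<in> P" using additive_subgroup.zero_closed[OF is_additive_subgroup] by (simp add: simps)
  have add: "additive P"
    unfolding additive_def
  proof (intro conjI ballI)
    fix x y assume xy: "x \<in> P" "y \<in> P"
    have "y * of_int (- 1) \<in> P" by (rule mult[OF xy(2) int])
    thus "x - y \<in> P" using plus[OF xy(1)] by fastforce
  qed fact
  have one: "1 \<notin> P"
  proof
    assume "1 \<in> P"
    hence "lat 1 w \<subseteq> P" using mult[of 1] by auto
    thus False using sub I_notcarr by (simp add: simps)
  qed
  obtain m where m: "n = int l * m" using l by blast
  have "w * (w - of_int t) = - of_int n" using w_sq by (simp add: algebra_simps)
  also have "\<dots> = of_nat l * of_int (- m)" by (simp add: m)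
  also have "\<dots> \<in> P" by (rule mult[OF lP int])
  finally have "w * (w - of_int t) \<in> P" .
  moreover have "w - of_int t \<in> lat 1 w" using lat_memI[of "- t" 1 1 w] by simp
  ultimately have or: "w \<in> P \<or> w - of_int t \<in> P"
    using I_prime[of w "w - of_int t"] lat_mem_right by (simp add: simps)
  have "P = lat (of_nat l) v" if v: "v \<in> P" "lat 1 v = lat 1 w" for v
  proof
    show "lat (of_nat l) v \<subseteq> P" using lP v(1) by (simp add: lat_subset_iff add)
    show "P \<subseteq> lat (of_nat l) v"
    proof
      fix x assume x: "x \<in> P"
      hence "x \<in> lat 1 v" using sub v(2) by blast
      then obtain i j where ij: "x = of_int i * 1 + of_int j * v" unfolding lat_iff by blast
      have "x - of_int j * v \<in> P" using x v(1) additive_diff[OF add] additive_of_int_mult[OF add] by simp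
      hence iP: "of_int i * 1 \<in> P" by (simp add: ij)
      have lP': "of_int (int l) * 1 \<in> P" using lP by simp
      have "int l dvd i"
      proof (rule ccontr)
        assume "\<not> int l dvd i"
        hence "gcd i (int l) = 1" using l(1) prime_imp_coprime[of "int l" i]
          by (simp add: coprime_iff_gcd_eq_1 gcd.commute)
        thus False using additive_bezout[OF add iP lP'] one by simp
      qed
      then obtain k where "i = int l * k" by blast
      hence "x = of_int k * of_nat l + of_int j * v" using ij by (simp add: mult.commute)
      thus "x \<in> lat (of_nat l) v" by (metis lat_memI)
    qed
  qed
  thus ?thesis using or shift(2)[of t] by metis
qed

end

section \<open>Torsion groups\<close>

text \<open>Only the part l^c of \<open>f\<close> matters, the cofactor being prime to
  \<open>l\<close>. For a <= c truncated subtraction gives exponent 0, and divisibility is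
  automatic; this is the source of max(a - c, 0).\<close>

lemma prime_power_dvd_mult_iff:
  fixes l f :: nat and i :: int
  assumes "prime l" "f > 0"
  shows "int l ^ a dvd int f * i \<longleftrightarrow> int l ^ (a - multiplicity l f) dvd i"
proof -
  define c where "c = multiplicity l f"
  obtain g where f: "f = l ^ c * g" and g: "\<not> l dvd g"
    using multiplicity_decompose'[of f l] assms(2) prime_gt_1_nat[OF assms(1)] by (auto simp: c_def)
  have l0: "int l \<noteq> 0" using assms(1) by auto
  have cop: "coprime (int l ^ k) (int g)" for k
    using prime_imp_coprime[OF assms(1) g] by simp
  show ?thesis unfolding c_def[symmetric]
  proof (cases "a \<le> c")
    case True
    hence "int l ^ a dvd int l ^ c" by (rule le_imp_power_dvd)
    thus "int l ^ a dvd int f * i \<longleftrightarrow> int l ^ (a - c) dvd i"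
      using True by (simp add: f mult.assoc)
  next
    case False
    hence "int l ^ a = int l ^ c * int l ^ (a - c)" by (simp flip: power_add)
    hence "int l ^ a dvd int f * i \<longleftrightarrow> int l ^ (a - c) dvd int g * i"
      using l0 by (simp add: f mult.assoc)
    also have "\<dots> \<longleftrightarrow> int l ^ (a - c) dvd i"
      by (rule coprime_dvd_mult_right_iff) (rule cop)
    finally show "int l ^ a dvd int f * i \<longleftrightarrow> int l ^ (a - c) dvd i" .
  qed
qed

text \<open>The integer part of f y is absorbed by Z. As \<open>v\<close> may be any generator, the
  order has the same diagonal shape for every translate.\<close>

lemma quadratic_order_lat:
  assumes "integers_of K = lat 1 v"
  shows "quadratic_order K f = lat 1 (of_nat f * v)"
proof (intro equalityI subsetI)
  fix x assume "x \<in> quadratic_order K f"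
  then obtain m y where x: "x = of_int m + of_nat f * y" and "y \<in> lat 1 v"
    by (auto simp: quadratic_order_def assms)
  then obtain i j where "y = of_int i * 1 + of_int j * v" unfolding lat_iff by blast
  hence "x = of_int (m + int f * i) * 1 + of_int j * (of_nat f * v)" by (simp add: x algebra_simps)
  thus "x \<in> lat 1 (of_nat f * v)" unfolding lat_iff by blast
next
  fix x assume "x \<in> lat 1 (of_nat f * v)"
  then obtain i j where "x = of_int i * 1 + of_int j * (of_nat f * v)" unfolding lat_iff by blast
  hence "x = of_int i + of_nat f * (of_int 0 * 1 + of_int j * v)" by (simp add: algebra_simps)
  thus "x \<in> quadratic_order K f" unfolding quadratic_order_def assms using lat_memI by blast
qed

lemma torus_torsion_eq:
  assumes add: "additive (integers_of K)" and I: "\<And>x y. x \<in> integers_of K \<Longrightarrow> y \<in> I \<Longrightarrow> y * x \<in> integers_of K"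
  shows "torus_torsion K I = {integers_of K +>\<^bsub>complex_field\<^esub> z | z. z \<in> colon (integers_of K) I}"
proof -
  have "torus_mult (integers_of K) b (integers_of K +>\<^bsub>complex_field\<^esub> z) = integers_of K
    \<longleftrightarrow> z * b \<in> integers_of K" if "b \<in> I" for b z
    using torus_mult_coset[of "integers_of K" "integers_of K" b z] that I add
    by (simp add: additive_add additive_def coset_self_iff mult.commute)
  thus ?thesis
    unfolding torus_torsion_def carrier_complex_torus one_complex_torus colon_def by blast
qed

text \<open>The single relation \<open>rel\<close> does both jobs: it presents the image as a
  quotient of Z^2, and it decides which torsion points lie in the kernel.\<close>

lemma torsion_group_isos:
  fixes f l c :: nat and v :: complex
  assumes O: "integers_of K = lat 1 v" and v: "Im v \<noteq> 0" and f: "f \<ge> 1"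
    and l: "prime l" and c: "c = multiplicity l f"
    and I: "\<And>x y. x \<in> integers_of K \<Longrightarrow> y \<in> I \<Longrightarrow> y * x \<in> integers_of K"
    and colon: "colon (integers_of K) I = lat (1 / of_nat l ^ a) (v / of_nat l ^ b)"
  shows "kernel_torsion_group K f I \<cong> integer_mod_group (l ^ min a c)"
    and "image_torsion_group K f I \<cong> integer_mod_group (l ^ (a - c)) \<times>\<times> integer_mod_group (l ^ b)"
proof -
  define R where "R = quadratic_order K f"
  have R: "R = lat 1 (of_nat f * v)" unfolding R_def by (rule quadratic_order_lat[OF O])
  have addO: "additive (integers_of K)" unfolding O by (rule additive_lat)
  have addR: "additive R" unfolding R by (rule additive_lat)
  have l0: "l \<noteq> 0" and l0': "int l \<noteq> 0" using l by auto
  have fv: "Im (of_nat f * v) \<noteq> 0" using f v by simp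
  have fO: "of_nat f * x \<in> R" if "x \<in> integers_of K" for x
    unfolding R_def quadratic_order_def using that by (force intro: exI[of _ 0])
  have torsion: "torus_torsion K I = {integers_of K +>\<^bsub>complex_field\<^esub> z | z. z \<in> colon (integers_of K) I}"
    by (rule torus_torsion_eq[OF addO I])
  have iota: "iota_dual K f (integers_of K +>\<^bsub>complex_field\<^esub> z) = R +>\<^bsub>complex_field\<^esub> (of_nat f * z)" for z
    unfolding iota_dual_def R_def[symmetric]
    by (rule torus_mult_coset) (use addO addR fO in \<open>auto simp: additive_add additive_def\<close>)
  \<comment> \<open>In the second coordinate f v is itself a basis vector of O, so l^b must divide
    \<open>j\<close> in full; in the first the factor f already supplies l^c.\<close>
  have rel: "of_int i * (of_nat f / of_nat l ^ a) + of_int j * (of_nat f * v / of_nat l ^ b) \<in> R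
      \<longleftrightarrow> int (l ^ (a - c)) dvd i \<and> int (l ^ b) dvd j" for i j
  proof -
    have eq: "of_int i * (of_nat f / of_nat l ^ a) + of_int j * (of_nat f * v / of_nat l ^ b)
      = of_int (int f * i) / of_int (int l ^ a) + of_int j / of_int (int l ^ b) * (of_nat f * v)"
      by simp
    have pos: "f > 0" "int l ^ a \<noteq> 0" "int l ^ b \<noteq> 0" using f l0' by simp_all
    show ?thesis
      unfolding eq R c frac_mem_lat_iff[OF fv pos(2,3)] prime_power_dvd_mult_iff[OF l pos(1)] by simp
  qed
  have image: "iota_dual K f ` torus_torsion K I = {R +>\<^bsub>complex_field\<^esub>
     (of_int i * (of_nat f / of_nat l ^ a) + of_int j * (of_nat f * v / of_nat l ^ b)) | i j. True}"
  proof -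
    have "of_nat f * (of_int i * (1 / of_nat l ^ a) + of_int j * (v / of_nat l ^ b))
      = of_int i * (of_nat f / of_nat l ^ a) + of_int j * (of_nat f * v / of_nat l ^ b)" for i j
      by (simp add: algebra_simps)
    moreover have "torus_torsion K I = {integers_of K +>\<^bsub>complex_field\<^esub>
        (of_int i * (1 / of_nat l ^ a) + of_int j * (v / of_nat l ^ b)) | i j. True}"
      unfolding torsion colon lat_def by blast
    moreover have "g ` {h i j | i j. True} = {g (h i j) | i j. True}" for g :: "complex set \<Rightarrow> complex set"
      and h :: "int \<Rightarrow> int \<Rightarrow> complex set" by blast
    ultimately show ?thesis by (simp only: iota)
  qed
  show "image_torsion_group K f I \<cong> integer_mod_group (l ^ (a - c)) \<times>\<times> integer_mod_group (l ^ b)"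
    unfolding image_torsion_group_def R_def[symmetric]
    by (rule torus_subgroup_iso_bicyclic[OF addR _ _ rel image]) (use l0 in auto)
  \<comment> \<open>The kernel is generated by l^(a - c) / l^a = 1 / l^m; the identity a = m + (a -
    c) also holds when the subtraction is truncated.\<close>
  define m where "m = min a c"
  have a: "a = m + (a - c)" by (simp add: m_def)
  have kz: "iota_dual K f (integers_of K +>\<^bsub>complex_field\<^esub> z) = R \<longleftrightarrow> of_nat f * z \<in> R" for z
    by (simp only: iota coset_self_iff[OF addR])
  have "iota_dual_kernel K f \<inter> torus_torsion K I
      = {integers_of K +>\<^bsub>complex_field\<^esub> z | z. z \<in> colon (integers_of K) I \<and> of_nat f * z \<in> R}"
  proof (intro equalityI subsetI)
    fix X assume X: "X \<in> iota_dual_kernel K f \<inter> torus_torsion K I"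
    then obtain z where z: "X = integers_of K +>\<^bsub>complex_field\<^esub> z" "z \<in> colon (integers_of K) I"
      unfolding torsion by blast
    moreover have "iota_dual K f X = R"
      using X by (simp add: iota_dual_kernel_def kernel_def one_complex_torus R_def)
    ultimately show "X \<in> {integers_of K +>\<^bsub>complex_field\<^esub> z | z. z \<in> colon (integers_of K) I \<and> of_nat f * z \<in> R}"
      using kz by blast
  next
    fix X assume "X \<in> {integers_of K +>\<^bsub>complex_field\<^esub> z | z. z \<in> colon (integers_of K) I \<and> of_nat f * z \<in> R}"
    then obtain z where z: "X = integers_of K +>\<^bsub>complex_field\<^esub> z" "z \<in> colon (integers_of K) I" "of_nat f * z \<in> R"
      by blast
    hence "iota_dual K f X = R" using kz by simp
    moreover have "X \<in> carrier (complex_torus (integers_of K))"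
      unfolding carrier_complex_torus z(1) by blast
    ultimately have "X \<in> iota_dual_kernel K f"
      by (simp add: iota_dual_kernel_def kernel_def one_complex_torus R_def)
    thus "X \<in> iota_dual_kernel K f \<inter> torus_torsion K I" using z(1,2) unfolding torsion by blast
  qed
  also have "\<dots> = {integers_of K +>\<^bsub>complex_field\<^esub> (of_int i * (1 / of_nat l ^ m)) | i. True}"
  proof (intro equalityI subsetI)
    fix X assume "X \<in> {integers_of K +>\<^bsub>complex_field\<^esub> z | z. z \<in> colon (integers_of K) I \<and> of_nat f * z \<in> R}"
    then obtain z where X: "X = integers_of K +>\<^bsub>complex_field\<^esub> z" and z: "z \<in> colon (integers_of K) I" "of_nat f * z \<in> R"
      by blast
    obtain i j where ij: "z = of_int i * (1 / of_nat l ^ a) + of_int j * (v / of_nat l ^ b)"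
      using z(1) unfolding colon lat_iff by blast
    have "of_nat f * z = of_int i * (of_nat f / of_nat l ^ a) + of_int j * (of_nat f * v / of_nat l ^ b)"
      by (simp add: ij algebra_simps)
    hence "int (l ^ (a - c)) dvd i" "int (l ^ b) dvd j" using z(2) rel by simp_all
    then obtain i' j' where i': "i = int (l ^ (a - c)) * i'" and j': "j = int (l ^ b) * j'" by blast
    have "of_int i * (1 / of_nat l ^ a) = of_int i' * (1 / of_nat l ^ m :: complex)"
      using l0 by (subst a) (simp add: i' power_add)
    moreover have "of_int j * (v / of_nat l ^ b) = of_int j' * v" using l0 by (simp add: j')
    ultimately have "z - of_int i' * (1 / of_nat l ^ m) = of_int 0 * 1 + of_int j' * v" by (simp add: ij)
    hence "z - of_int i' * (1 / of_nat l ^ m) \<in> integers_of K" unfolding O by (simp only: lat_memI)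
    hence "X = integers_of K +>\<^bsub>complex_field\<^esub> (of_int i' * (1 / of_nat l ^ m))"
      unfolding X coset_eq_iff[OF addO] .
    thus "X \<in> {integers_of K +>\<^bsub>complex_field\<^esub> (of_int i * (1 / of_nat l ^ m)) | i. True}" by blast
  next
    fix X assume "X \<in> {integers_of K +>\<^bsub>complex_field\<^esub> (of_int i * (1 / of_nat l ^ m)) | i. True}"
    then obtain i where X: "X = integers_of K +>\<^bsub>complex_field\<^esub> (of_int i * (1 / of_nat l ^ m))" by blast
    define i' where "i' = int (l ^ (a - c)) * i"
    have eq: "of_int i * (1 / of_nat l ^ m) = of_int i' * (1 / of_nat l ^ a) + of_int 0 * (v / of_nat l ^ b)"
      using l0 by (subst a) (simp add: i'_def power_add)
    have "of_int i * (1 / of_nat l ^ m) \<in> colon (integers_of K) I"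
      unfolding colon eq by (rule lat_memI)
    moreover have "of_nat f * (of_int i * (1 / of_nat l ^ m)) \<in> R"
    proof -
      have "of_nat f * (of_int i * (1 / of_nat l ^ m))
        = of_int i' * (of_nat f / of_nat l ^ a) + of_int 0 * (of_nat f * v / of_nat l ^ b)"
        unfolding eq by simp
      also have "\<dots> \<in> R" unfolding rel by (simp add: i'_def)
      finally show ?thesis .
    qed
    ultimately show "X \<in> {integers_of K +>\<^bsub>complex_field\<^esub> z | z. z \<in> colon (integers_of K) I \<and> of_nat f * z \<in> R}"
      unfolding X by blast
  qed
  finally have kernel: "iota_dual_kernel K f \<inter> torus_torsion K I
    = {integers_of K +>\<^bsub>complex_field\<^esub> (of_int i * (1 / of_nat l ^ m)) | i. True}" .
  have relO: "of_int i * (1 / of_nat l ^ m) \<in> integers_of K \<longleftrightarrow> int (l ^ m) dvd i" for i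
    using frac_mem_lat_iff[OF v, of "int l ^ m" 1 i 0] l0' by (simp add: O)
  show "kernel_torsion_group K f I \<cong> integer_mod_group (l ^ min a c)"
    unfolding kernel_torsion_group_def m_def[symmetric]
    by (rule torus_subgroup_iso_cyclic[OF addO _ relO kernel]) (use l0 in auto)
qed

section \<open>Torsion groups for split, ramified and principal ideals\<close>

context quadratic_integers begin

lemma integers_mult: "x \<in> lat 1 w \<Longrightarrow> y \<in> lat 1 w \<Longrightarrow> x * y \<in> lat 1 w"
  using stable_mult[OF stable_integers] by blast

lemma ideal_prod_subset:
  assumes "integers_of K = lat 1 w" "I \<subseteq> lat 1 w" "J \<subseteq> lat 1 w"
  shows "I \<cdot>\<^bsub>integer_ring K\<^esub> J \<subseteq> lat 1 w"
proof
  fix x assume "x \<in> I \<cdot>\<^bsub>integer_ring K\<^esub> J"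
  thus "x \<in> lat 1 w"
  proof (induction rule: ideal_prod.induct)
    case (prod i j)
    hence "i \<in> lat 1 w" "j \<in> lat 1 w" using assms(2,3) by auto
    thus ?case using integers_mult by (simp add: integer_ring_def complex_field_def)
  next
    case (sum x y)
    thus ?case using additive_add[OF additive_lat] by (simp add: integer_ring_def complex_field_def)
  qed
qed

lemma ideal_power_subset:
  assumes "integers_of K = lat 1 w" "P \<subseteq> lat 1 w"
  shows "ideal_power K P k \<subseteq> lat 1 w"
proof (induction k)
  case 0
  show ?case by (simp add: nat_pow_def ideals_set_def integer_ring_def assms(1))
next
  case (Suc k)
  have "ideal_power K P (Suc k) = ideal_power K P k \<cdot>\<^bsub>integer_ring K\<^esub> P"
    by (simp add: nat_pow_def ideals_set_def)
  thus ?case using ideal_prod_subset[OF assms(1) Suc.IH assms(2)] by simp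
qed

lemma primes_over_subset:
  assumes "integers_of K = lat 1 w" "P \<in> primes_over K l"
  shows "P \<subseteq> lat 1 w"
proof -
  have "ideal P (integer_ring K)" using assms(2) by (simp add: primes_over_def primeideal_def)
  hence "P \<subseteq> carrier (integer_ring K)"
    by (simp add: ideal_def additive_subgroup.a_subset)
  thus ?thesis by (simp add: integer_ring_def assms(1))
qed

text \<open>Distinctness of the primes keeps \<open>l\<close> from dividing \<open>t\<close>, for
  otherwise (l, w) = (l, w - t); so 0 is a simple root modulo \<open>l\<close>. The adapted
  generator is w - r, where r comes from \<open>colon_split\<close> for the given exponents.\<close>

lemma split_isos:
  assumes O: "integers_of K = lat 1 w" and f: "f \<ge> 1" and l: "prime l" and c: "c = multiplicity l f"
    and n: "int l dvd n" and P: "P1 \<in> primes_over K l" "P2 \<in> primes_over K l"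
    and eq: "P1 = lat (of_nat l) w" "P2 = lat (of_nat l) (w - of_int t)" and ne: "P1 \<noteq> P2" and ab: "a \<le> b"
    and I: "I = ideal_power K P1 a \<cdot>\<^bsub>integer_ring K\<^esub> ideal_power K P2 b"
  shows "kernel_torsion_group K f I \<cong> integer_mod_group (l ^ min a c) \<and>
    image_torsion_group K f I \<cong> integer_mod_group (l ^ (a - c)) \<times>\<times> integer_mod_group (l ^ b)"
proof -
  have "\<not> int l dvd t"
  proof
    assume "int l dvd t"
    then obtain k where "t = int l * k" by blast
    hence "w - of_int t = w + of_int (- k) * of_nat l" by simp
    hence "P1 = P2" unfolding eq by (simp only: lat_shift)
    thus False using ne by simp
  qed
  from colon_split[OF _ this n ab] l obtain r where
    r: "colon_power P2 b (colon_power P1 a (lat 1 w)) = lat (1 / of_nat l ^ a) ((w - of_int r) / of_nat l ^ b)"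
    by (auto simp: eq)
  have st: "stable (colon_power P1 a (lat 1 w))"
    by (induction a) (simp_all add: colon_power_Suc stable_colon stable_integers)
  have colon: "colon (lat 1 w) I = lat (1 / of_nat l ^ a) ((w - of_int r) / of_nat l ^ b)"
    unfolding I colon_ideal_prod[OF additive_lat] colon_ideal_power[OF stable_integers O]
      colon_ideal_power[OF st O] by (rule r)
  have sub: "I \<subseteq> lat 1 w" unfolding I
    by (intro ideal_prod_subset ideal_power_subset O primes_over_subset[OF O P(1)]
        primes_over_subset[OF O P(2)])
  interpret s: quadratic_integers "w - of_int r" "t - 2 * r" "r\<^sup>2 - t * r + n" by (rule shift)
  have "y * x \<in> integers_of K" if "x \<in> integers_of K" "y \<in> I" for x y
    using that sub integers_mult unfolding O by blast
  from torsion_group_isos[OF _ s.w_im f l c this, where a = a and b = b] show ?thesis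
    using colon by (simp add: O shift(2))
qed

lemma ramified_isos:
  assumes O: "integers_of K = lat 1 w" and K: "w / of_nat l \<in> K"
    and f: "f \<ge> 1" and l: "prime l" and c: "c = multiplicity l f"
    and n: "int l dvd n" and t: "int l dvd t" and P: "P \<in> primes_over K l"
    and I: "I = ideal_power K P d"
  shows "kernel_torsion_group K f I \<cong> integer_mod_group (l ^ min (d div 2) c) \<and>
    image_torsion_group K f I \<cong> integer_mod_group (l ^ (d div 2 - c)) \<times>\<times> integer_mod_group (l ^ ((d + 1) div 2))"
proof -
  have l0: "int l \<noteq> 0" "prime (int l)" using l by auto
  txt \<open>Otherwise \<open>w / l\<close> would be an integer of \<open>K\<close> outside \<open>\<int> + \<int> w\<close>.\<close>
  have n2: "\<not> (int l)\<^sup>2 dvd n"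
  proof
    assume "(int l)\<^sup>2 dvd n"
    then obtain m where m: "n = (int l)\<^sup>2 * m" by blast
    obtain u where u: "t = int l * u" using t by blast
    have "w / of_nat l * (w / of_nat l) = (w * w) / (of_nat l)\<^sup>2" by (simp add: power2_eq_square)
    also have "\<dots> = of_int u * (w / of_nat l) - of_int m"
      using l0 by (simp add: w_sq u m power2_eq_square field_simps)
    finally have "algebraic_int (w / of_nat l)" by (rule algebraic_int_quadraticI)
    hence "w / of_nat l \<in> integers_of K" using K by (simp add: integers_of_def)
    hence "of_int 0 / of_int 1 + of_int 1 / of_int (int l) * w \<in> lat 1 w" by (simp add: O)
    hence "int l dvd 1" using frac_mem_lat_iff[OF w_im _ l0(1), of 1 0 1] by simp
    thus False using l0(2) by auto
  qed
  \<comment> \<open>Since \<open>l\<close> divides \<open>t\<close>, the two candidates for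
    \<open>P\<close> coincide.\<close>
  have "P = lat (of_nat l) w"
  proof -
    obtain k where "t = int l * k" using t by blast
    hence "w - of_int t = w + of_int (- k) * of_nat l" by simp
    hence "lat (of_nat l) (w - of_int t) = lat (of_nat l) w" by (simp only: lat_shift)
    thus ?thesis using primes_over_cases[OF O l0(2) n P] by simp
  qed
  hence colon: "colon (lat 1 w) I = lat (1 / of_nat l ^ (d div 2)) (w / of_nat l ^ ((d + 1) div 2))"
    unfolding I colon_ideal_power[OF stable_integers O]
    using colon_power_ramified[OF l0(2) t n n2, of d] by simp
  have sub: "I \<subseteq> lat 1 w" unfolding I
    by (intro ideal_power_subset O primes_over_subset[OF O P])
  have "y * x \<in> integers_of K" if "x \<in> integers_of K" "y \<in> I" for x y
    using that sub integers_mult unfolding O by blast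
  from torsion_group_isos[OF O w_im f l c this] show ?thesis
    using colon by (simp add: O)
qed

text \<open>Division by l^b scales both coordinates alike, so \<open>w\<close> itself is adapted,
  with both exponents equal to b.\<close>

lemma principal_isos:
  assumes O: "integers_of K = lat 1 w"
    and f: "f \<ge> 1" and l: "prime l" and c: "c = multiplicity l f"
    and I: "I = PIdl\<^bsub>integer_ring K\<^esub> (of_nat l ^ b)"
  shows "kernel_torsion_group K f I \<cong> integer_mod_group (l ^ min b c) \<and>
    image_torsion_group K f I \<cong> integer_mod_group (l ^ (b - c)) \<times>\<times> integer_mod_group (l ^ b)"
proof -
  have I': "I = {x * of_nat l ^ b | x. x \<in> lat 1 w}"
    unfolding I cgenideal_def by (simp add: integer_ring_def complex_field_def O)
  have lb: "of_nat l ^ b \<in> lat 1 w" using lat_memI[of "int (l ^ b)" 1 0 w] by simp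
  have sub: "I \<subseteq> lat 1 w" unfolding I' using integers_mult lb by blast
  have "colon (lat 1 w) I = colon (lat 1 w) {of_nat l ^ b}"
  proof (intro equalityI subsetI)
    fix z assume "z \<in> colon (lat 1 w) I"
    moreover have "1 * of_nat l ^ b \<in> I" unfolding I' using lat_mem_left by blast
    ultimately show "z \<in> colon (lat 1 w) {of_nat l ^ b}" by (simp add: colon_def)
  next
    fix z assume "z \<in> colon (lat 1 w) {of_nat l ^ b}"
    hence z: "z * of_nat l ^ b \<in> lat 1 w" by (simp add: colon_def)
    have "z * (x * of_nat l ^ b) \<in> lat 1 w" if "x \<in> lat 1 w" for x
      using integers_mult[OF z that] by (simp add: ac_simps)
    thus "z \<in> colon (lat 1 w) I" unfolding colon_def I' by blast
  qed
  also have "\<dots> = lat (1 / of_nat l ^ b) (w / of_nat l ^ b)"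
    using colon_power_scale_lat[of "of_nat l ^ b" 1 1 w] l by (simp add: colon_power_Suc prime_gt_0_nat)
  finally have colon: "colon (lat 1 w) I = lat (1 / of_nat l ^ b) (w / of_nat l ^ b)" .
  have "y * x \<in> integers_of K" if "x \<in> integers_of K" "y \<in> I" for x y
    using that sub integers_mult unfolding O by blast
  from torsion_group_isos[OF O w_im f l c this] show ?thesis
    using colon by (simp add: O)
qed

end

section \<open>Roots of the minimal polynomial modulo l\<close>

lemma prime_odd_halving:
  assumes "prime l" "l \<noteq> 2"
  shows "\<exists>s. int l dvd 2 * s - x"
proof -
  have "odd l" using assms by (metis primes_dvd_imp_eq two_is_prime_nat)
  hence "coprime 2 (int l)" by simp
  then obtain u where "[2 * u = 1] (mod int l)" using cong_solve_coprime_int by blast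
  hence "int l dvd 2 * u - 1" by (simp add: cong_iff_dvd_diff)
  hence "int l dvd (2 * u - 1) * x" by (rule dvd_mult2)
  hence "int l dvd 2 * (u * x) - x" by (simp add: algebra_simps)
  thus ?thesis by blast
qed

lemma prime_dvd_4_mult:
  assumes "prime l" "l \<noteq> 2" "int l dvd 4 * x"
  shows "int l dvd x"
proof -
  have "odd l" using assms by (metis primes_dvd_imp_eq two_is_prime_nat)
  hence "coprime (int l) (2 ^ 2)" by (simp only: coprime_power_right_iff) simp
  hence "coprime (int l) 4" by simp
  thus ?thesis using assms(3) coprime_dvd_mult_right_iff by blast
qed

text \<open>By 4 (s^2 - t s + n) = (2 s - t)^2 - D, a square root y of D modulo an odd
  \<open>l\<close> gives the root s = (t + y) / 2. For l = 2 halving is impossible and the residue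
  of D mod 8 decides.\<close>

lemma kronecker_split_root:
  assumes l: "prime l" and "kronecker_prime (t\<^sup>2 - 4 * n) l = 1"
  shows "\<exists>s. int l dvd s\<^sup>2 - t * s + n"
proof (cases "l = 2")
  case True
  define D where "D = t\<^sup>2 - 4 * n"
  have D: "odd D" "D mod 8 = 1 \<or> D mod 8 = 7"
    using assms(2) True by (auto simp: kronecker_prime_def D_def split: if_splits)
  hence "odd t" by (simp add: D_def)
  then obtain k where "t = 2 * k + 1" by (auto elim: oddE)
  hence "t\<^sup>2 = 4 * (k * (k + 1)) + 1" by (simp add: power2_eq_square algebra_simps)
  moreover have "even (k * (k + 1))" by simp
  then obtain m where "k * (k + 1) = 2 * m" by blast
  ultimately have "D = 8 * m + 1 - 4 * n" by (simp add: D_def)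
  \<comment> \<open>D = 1 - 4 n mod 8 is 1 or 5 mod 8, and the symbol leaves only 1.\<close>
  hence "even n" using D(2) by presburger
  thus ?thesis using True by (intro exI[of _ 0]) simp
next
  case False
  hence "QuadRes (int l) (t\<^sup>2 - 4 * n)"
    using assms(2) by (auto simp: kronecker_prime_def Legendre_def split: if_splits)
  then obtain y where "[y\<^sup>2 = t\<^sup>2 - 4 * n] (mod int l)" by (auto simp: QuadRes_def)
  hence y: "int l dvd y\<^sup>2 - (t\<^sup>2 - 4 * n)" by (simp add: cong_iff_dvd_diff)
  obtain s where s: "int l dvd 2 * s - (t + y)" using prime_odd_halving[OF l False] by blast
  have "4 * (s\<^sup>2 - t * s + n) = (2 * s - (t + y)) * (2 * s - t + y) + (y\<^sup>2 - (t\<^sup>2 - 4 * n))"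
    by (simp add: power2_eq_square algebra_simps)
  hence "int l dvd 4 * (s\<^sup>2 - t * s + n)" using dvd_add[OF dvd_mult2[OF s] y] by metis
  thus ?thesis using prime_dvd_4_mult[OF l False] by blast
qed

text \<open>The second condition says that \<open>s\<close> is a double root: t - 2 s is the trace
  of w - s, so both trace and norm of this translate are divisible by \<open>l\<close>.\<close>

lemma kronecker_ramified_root:
  assumes l: "prime l" and "kronecker_prime (t\<^sup>2 - 4 * n) l = 0"
  shows "\<exists>s. int l dvd s\<^sup>2 - t * s + n \<and> int l dvd t - 2 * s"
proof (cases "l = 2")
  case True
  hence "even t" using assms(2) by (auto simp: kronecker_prime_def split: if_splits)
  \<comment> \<open>For even t the polynomial s^2 - t s + n is s + n modulo 2, so s = n is a
    root.\<close>
  thus ?thesis using True by (intro exI[of _ n]) simp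
next
  case False
  hence D: "int l dvd t\<^sup>2 - 4 * n"
    using assms(2) by (auto simp: kronecker_prime_def Legendre_def cong_0_iff split: if_splits)
  obtain s where s: "int l dvd 2 * s - t" using prime_odd_halving[OF l False] by blast
  have "4 * (s\<^sup>2 - t * s + n) = (2 * s - t) * (2 * s - t) - (t\<^sup>2 - 4 * n)"
    by (simp add: power2_eq_square algebra_simps)
  hence "int l dvd 4 * (s\<^sup>2 - t * s + n)" using dvd_diff[OF dvd_mult2[OF s] D] by metis
  moreover have "int l dvd t - 2 * s" using s by (simp add: dvd_diff_commute)
  ultimately show ?thesis using prime_dvd_4_mult[OF l False] by blast
qed

theorem theorem3p1:
  fixes K :: "complex set" and f l c :: nat
  assumes "imaginary_quadratic_field K"
    and "f \<ge> 1"
    and "Factorial_Ring.prime l"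
    and "c = Factorial_Ring.multiplicity l f"
  shows "(kronecker_prime (field_discriminant K) l = 1 \<longrightarrow>
           (\<forall>p1\<in>primes_over K l. \<forall>p2\<in>primes_over K l. p1 \<noteq> p2 \<longrightarrow>
             (\<forall>a b :: nat. a \<le> b \<longrightarrow>
               (let I = ideal_power K p1 a \<cdot>\<^bsub>integer_ring K\<^esub> ideal_power K p2 b in
                 kernel_torsion_group K f I \<cong> integer_mod_group (l ^ min a c) \<and>
                 image_torsion_group K f I
                   \<cong> integer_mod_group (l ^ (a - c)) \<times>\<times> integer_mod_group (l ^ b))))) \<and>
         (kronecker_prime (field_discriminant K) l = 0 \<longrightarrow>
           (\<forall>p\<in>primes_over K l. \<forall>d :: nat. d \<ge> 1 \<longrightarrow>
             (let I = ideal_power K p d in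
               kernel_torsion_group K f I
                 \<cong> integer_mod_group (l ^ min c (nat \<lfloor>real d / 2\<rfloor>)) \<and>
               image_torsion_group K f I
                 \<cong> integer_mod_group (l ^ (nat \<lfloor>real d / 2\<rfloor> - c))
                     \<times>\<times> integer_mod_group (l ^ nat \<lceil>real d / 2\<rceil>)))) \<and>
         (kronecker_prime (field_discriminant K) l = - 1 \<longrightarrow>
           (\<forall>b :: nat. b \<ge> 1 \<longrightarrow>
             (let I = PIdl\<^bsub>integer_ring K\<^esub> (of_nat l ^ b) in
               kernel_torsion_group K f I \<cong> integer_mod_group (l ^ min b c) \<and>
               image_torsion_group K f I
                 \<cong> integer_mod_group (l ^ (b - c)) \<times>\<times> integer_mod_group (l ^ b))))"
proof -
  obtain w t n where O: "integers_of K = lat 1 w" and w: "w * w = of_int t * w - of_int n" "Im w \<noteq> 0"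
    and K: "K = {p + q * w | p q. p \<in> \<rat> \<and> q \<in> \<rat>}"
    using imaginary_quadratic_integral_generator[OF assms(1)] .
  interpret quadratic_integers w t n using w by unfold_locales
  have D: "field_discriminant K = t\<^sup>2 - 4 * n" by (rule field_discriminant_eq[OF O w])
  have pl: "prime (int l)" using assms(3) by simp
  show ?thesis
    unfolding D Let_def
  \<comment> \<open>The instance of \<open>conjI\<close> splits only conjunctions that start with an
    implication, so each pair of isomorphisms stays one goal.\<close>
  proof (intro conjI[of "_ \<longrightarrow> _"] impI ballI allI)
    fix p1 p2 and a b :: nat
    assume kr: "kronecker_prime (t\<^sup>2 - 4 * n) l = 1" and p1: "p1 \<in> primes_over K l" and p2: "p2 \<in> primes_over K l"
      and ne: "p1 \<noteq> p2" and ab: "a \<le> b"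
    let ?I = "ideal_power K p1 a \<cdot>\<^bsub>integer_ring K\<^esub> ideal_power K p2 b"
    \<comment> \<open>Translating \<open>w\<close> by this root brings the generator to the normal
      form in which \<open>l\<close> divides the norm.\<close>
    obtain s where root: "int l dvd s\<^sup>2 - t * s + n" using kronecker_split_root[OF assms(3) kr] by blast
    interpret s: quadratic_integers "w - of_int s" "t - 2 * s" "s\<^sup>2 - t * s + n" by (rule shift)
    have Os: "integers_of K = lat 1 (w - of_int s)" by (simp add: O shift(2))
    have cases: "p = lat (of_nat l) (w - of_int s) \<or> p = lat (of_nat l) (w - of_int s - of_int (t - 2 * s))"
      if "p \<in> primes_over K l" for p
      by (rule s.primes_over_cases[OF Os pl root that])
    show "kernel_torsion_group K f ?I \<cong> integer_mod_group (l ^ min a c) \<and>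
      image_torsion_group K f ?I \<cong> integer_mod_group (l ^ (a - c)) \<times>\<times> integer_mod_group (l ^ b)"
    txt \<open>In the second case the roles of the two roots \<open>s\<close> and \<open>t - s\<close> are exchanged.\<close>
    proof (cases "p1 = lat (of_nat l) (w - of_int s)")
      case True
      hence "p2 = lat (of_nat l) (w - of_int s - of_int (t - 2 * s))" using cases[OF p2] ne by auto
      thus ?thesis
        using s.split_isos[OF Os assms(2-4) root p1 p2 True _ ne ab refl] by blast
    next
      case False
      define r where "r = t - s"
      have p1': "p1 = lat (of_nat l) (w - of_int r)"
        using cases[OF p1] False by (simp add: r_def algebra_simps)
      \<comment> \<open>Here w - r - (t - 2 r) = w - s.\<close>
      have p2': "p2 = lat (of_nat l) (w - of_int r - of_int (t - 2 * r))"
        using cases[OF p1] cases[OF p2] False ne by (simp add: r_def algebra_simps)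
      interpret r: quadratic_integers "w - of_int r" "t - 2 * r" "r\<^sup>2 - t * r + n" by (rule shift)
      have Or: "integers_of K = lat 1 (w - of_int r)" by (simp add: O shift(2))
      have "r\<^sup>2 - t * r + n = s\<^sup>2 - t * s + n" by (simp add: r_def power2_eq_square algebra_simps)
      hence rootr: "int l dvd r\<^sup>2 - t * r + n" using root by simp
      show ?thesis by (rule r.split_isos[OF Or assms(2-4) rootr p1 p2 p1' p2' ne ab refl])
    qed
  next
    fix p and d :: nat
    assume kr: "kronecker_prime (t\<^sup>2 - 4 * n) l = 0" and p: "p \<in> primes_over K l" and d: "d \<ge> 1"
    obtain s where root: "int l dvd s\<^sup>2 - t * s + n" "int l dvd t - 2 * s"
      using kronecker_ramified_root[OF assms(3) kr] by blast
    interpret s: quadratic_integers "w - of_int s" "t - 2 * s" "s\<^sup>2 - t * s + n" by (rule shift)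
    have Os: "integers_of K = lat 1 (w - of_int s)" by (simp add: O shift(2))
    have "(w - of_int s) / of_nat l = - of_int s / of_nat l + 1 / of_nat l * w"
      by (simp add: diff_divide_distrib)
    moreover have "- of_int s / of_nat l \<in> (\<rat> :: complex set)" "1 / of_nat l \<in> (\<rat> :: complex set)" by simp_all
    ultimately have wK: "(w - of_int s) / of_nat l \<in> K" unfolding K by blast
    have fl: "nat \<lfloor>real d / 2\<rfloor> = d div 2" using floor_divide_of_nat_eq[of d 2, where ?'a = real] by simp
    have ce: "nat \<lceil>real d / 2\<rceil> = (d + 1) div 2"
      by (cases "even d") (auto elim!: evenE oddE intro!: ceiling_unique simp: nat_eq_iff)
    show "kernel_torsion_group K f (ideal_power K p d) \<cong> integer_mod_group (l ^ min c (nat \<lfloor>real d / 2\<rfloor>)) \<and>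
      image_torsion_group K f (ideal_power K p d) \<cong> integer_mod_group (l ^ (nat \<lfloor>real d / 2\<rfloor> - c))
        \<times>\<times> integer_mod_group (l ^ nat \<lceil>real d / 2\<rceil>)"
      using s.ramified_isos[OF Os wK assms(2-4) root p refl] unfolding fl ce by (simp only: min.commute)
  next
    fix b :: nat
    show "kernel_torsion_group K f (PIdl\<^bsub>integer_ring K\<^esub> (of_nat l ^ b)) \<cong> integer_mod_group (l ^ min b c) \<and>
      image_torsion_group K f (PIdl\<^bsub>integer_ring K\<^esub> (of_nat l ^ b))
        \<cong> integer_mod_group (l ^ (b - c)) \<times>\<times> integer_mod_group (l ^ b)"
      by (rule principal_isos[OF O assms(2-4) refl])
  qed
qed

end
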